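(* Let $\boldsymbol Z^{(1)},\ldots,\boldsymbol Z^{(n)}$ be i.i.d. random vectors in $\mathbb R_+^d$ with tail equivalent marginal distributions and $\boldsymbol Z^{(1)}\in\mathcal{MRV}(\alpha_i,b_i,\mu_i,\mathbb E_d^{(i)})$ for $i=1,\ldots,d$. Moreover, assume that $\alpha_i<\alpha_m+\alpha_{i-m}$ for all $m=1,\ldots,i-1$ and $i=2,\ldots,d$. Then $$\sum_{k=1}^n\boldsymbol Z^{(k)}\in\mathcal{MRV}(\alpha_i,b_i,n\mu_i,\mathbb E_d^{(i)})\qquad\text{for } i=1,\ldots,d.$$
   Context: $\mathbb R_+^d=[0,\infty)^d$ carries the sup-norm metric; $z_{(1)}\ge\cdots\ge z_{(d)}$ are the decreasing order statistics of $\boldsymbol z\in\mathbb R_+^d$. For $0\le i\le d-1$ let $\mathbb{CA}_d^{(i)}=\{\boldsymbol z\in\mathbb R_+^d: z_{(i+1)}=0\}$, and for $1\le i\le d$ let $\mathbb E_d^{(i)}=\mathbb R_+^d\setminus\mathbb{CA}_d^{(i-1)}=\{\boldsymbol z\in\mathbb R_+^d: z_{(i)}>0\}$. $\mathbb M(\mathbb E_d^{(i)})$ is the set of Borel measures on $\mathbb E_d^{(i)}$ that are finite on Borel sets bounded away from (at positive distance from) $\mathbb{CA}_d^{(i-1)}$; $\mu_t\to\mu$ in $\mathbb M(\mathbb E_d^{(i)})$ means $\int f\,d\mu_t\to\int f\,d\mu$ for all bounded continuous real $f$ on $\mathbb E_d^{(i)}$ with support bounded away from $\mathbb{CA}_d^{(i-1)}$.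 A function $f:\mathbb R_+\to\mathbb R_+$ is in $\mathcal{RV}_\beta$ if $f(tx)/f(t)\to x^\beta$ as $t\to\infty$ for all $x>0$. A random vector $\boldsymbol Z\in\mathbb R_+^d$ is multivariate regularly varying, $\boldsymbol Z\in\mathcal{MRV}(\alpha,b,\mu,\mathbb E_d^{(i)})$, if $\alpha>0$, $b\in\mathcal{RV}_{1/\alpha}$, $\mu\in\mathbb M(\mathbb E_d^{(i)})$ is non-null and $t\,\mathbb P(\boldsymbol Z/b(t)\in\cdot)\to\mu(\cdot)$ in $\mathbb M(\mathbb E_d^{(i)})$ as $t\to\infty$. Distribution functions $F,G$ are tail equivalent if $(1-F(t))/(1-G(t))\to c$ for some $c\in(0,\infty)$ as $t\to\infty$. *)

theory Defs
  imports "HOL-Probability.Probability"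
begin

text \<open>The dimension \<open>d\<close> is \<open>CARD('d)\<close>, and \<open>\<real>\<^sub>+\<^sup>d\<close> is the nonnegative orthant of
  \<^typ>\<open>real ^ 'd\<close>.  The library metric there is Euclidean; the sup-norm induces the same topology
  (hence the same continuous functions and Borel sets), so the sup-norm is only spelled out,
  as \<^const>\<open>infnorm\<close>, where the distance itself is used.\<close>

definition nonneg_orthant :: "(real ^ 'd) set" where
  "nonneg_orthant = {z. \<forall>j. 0 \<le> z $ j}"

text \<open>\<open>order_stat i z\<close> is the \<open>i\<close>-th largest entry of \<open>z\<close>, counted with multiplicity; it is only
  meaningful for \<open>1 \<le> i \<le> d\<close>.\<close>

definition order_stat :: "nat \<Rightarrow> real ^ 'd \<Rightarrow> real" where
  "order_stat i z =
     rev (sorted_list_of_multiset (image_mset (\<lambda>j. z $ j) (mset_set UNIV))) ! (i - 1)"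

definition CA :: "nat \<Rightarrow> (real ^ 'd) set" where
  "CA i = {z \<in> nonneg_orthant. order_stat (i + 1) z = 0}"

definition EE :: "nat \<Rightarrow> (real ^ 'd) set" where
  "EE i = nonneg_orthant - CA (i - 1)"

definition bounded_away :: "(real ^ 'd) set \<Rightarrow> (real ^ 'd) set \<Rightarrow> bool" where
  "bounded_away A C \<longleftrightarrow> (\<exists>\<epsilon>>0. \<forall>x\<in>A. \<forall>y\<in>C. \<epsilon> \<le> infnorm (x - y))"

definition MM :: "nat \<Rightarrow> (real ^ 'd) measure set" where
  "MM i = {\<mu>. sets \<mu> = sets (restrict_space borel (EE i)) \<and>
              (\<forall>A\<in>sets \<mu>. bounded_away A (CA (i - 1)) \<longrightarrow> emeasure \<mu> A < \<infinity>)}"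

definition MM_test_function :: "nat \<Rightarrow> (real ^ 'd \<Rightarrow> real) \<Rightarrow> bool" where
  "MM_test_function i f \<longleftrightarrow>
     continuous_on (EE i) f \<and> bounded (f ` EE i) \<and>
     bounded_away (EE i \<inter> closure {x \<in> EE i. f x \<noteq> 0}) (CA (i - 1))"

definition MM_converges ::
    "nat \<Rightarrow> (real \<Rightarrow> (real ^ 'd) measure) \<Rightarrow> (real ^ 'd) measure \<Rightarrow> bool" where
  "MM_converges i \<mu>t \<mu> \<longleftrightarrow>
     (\<forall>f. MM_test_function i f \<longrightarrow>
        ((\<lambda>t. \<integral>x. f x \<partial>(\<mu>t t)) \<longlongrightarrow> (\<integral>x. f x \<partial>\<mu>)) at_top)"

text \<open>No measurability of \<open>f\<close> is required.  Since \<open>0 / 0 = 0\<close>, the instance \<open>x = 1\<close> forces \<open>f\<close> to be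
  eventually positive.\<close>

definition regularly_varying :: "real \<Rightarrow> (real \<Rightarrow> real) \<Rightarrow> bool" where
  "regularly_varying \<beta> f \<longleftrightarrow>
     (\<forall>t\<ge>0. 0 \<le> f t) \<and> (\<forall>x>0. ((\<lambda>t. f (t * x) / f t) \<longlongrightarrow> x powr \<beta>) at_top)"

text \<open>The measure \<open>t P(Z / s \<in> \<cdot>)\<close> on \<open>EE i\<close>.\<close>

definition scaled_law ::
    "nat \<Rightarrow> 'a measure \<Rightarrow> ('a \<Rightarrow> real ^ 'd) \<Rightarrow> real \<Rightarrow> real \<Rightarrow> (real ^ 'd) measure" where
  "scaled_law i P Z t s =
     scale_measure (ennreal t) (restrict_space (distr P borel (\<lambda>\<omega>. Z \<omega> /\<^sub>R s)) (EE i))"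

definition MRV ::
    "'a measure \<Rightarrow> ('a \<Rightarrow> real ^ 'd) \<Rightarrow> real \<Rightarrow> (real \<Rightarrow> real) \<Rightarrow> (real ^ 'd) measure \<Rightarrow> nat \<Rightarrow> bool" where
  "MRV P Z \<alpha> b \<mu> i \<longleftrightarrow>
     Z \<in> borel_measurable P \<and> (\<forall>\<omega>\<in>space P. Z \<omega> \<in> nonneg_orthant) \<and>
     0 < \<alpha> \<and> regularly_varying (1 / \<alpha>) b \<and>
     \<mu> \<in> MM i \<and> emeasure \<mu> (space \<mu>) \<noteq> 0 \<and>
     MM_converges i (\<lambda>t. scaled_law i P Z t (b t)) \<mu>"

definition tail_equivalent :: "(real \<Rightarrow> real) \<Rightarrow> (real \<Rightarrow> real) \<Rightarrow> bool" where
  "tail_equivalent F G \<longleftrightarrow> (\<exists>c>0. ((\<lambda>t. (1 - F t) / (1 - G t)) \<longlongrightarrow> c) at_top)"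

end

theory Submission
  imports Defs
begin

text \<open>The reason is the principle of a single big jump, applied to each cone \<open>EE i\<close>.  A sum \<open>X + Y\<close> of two
independent vectors has \<open>i\<close> entries of order \<open>b i t\<close> only if the large entries of \<open>X\<close> and those of
\<open>Y\<close> together number at least \<open>i\<close>.  Either one summand supplies all of them while every entry of the
other is small, or both have large entries, and then for some \<open>m\<close> there are \<open>m\<close> in \<open>X\<close> and
\<open>max 1 (i - m)\<close> in \<open>Y\<close>.  By independence the second event has probability of order
\<open>x powr - (\<alpha> m + \<alpha> (i - m))\<close> at level \<open>x = b i t\<close>, whereas \<open>1 / t\<close> is of order \<open>x powr - \<alpha> i\<close>, up to
arbitrarily small changes of the exponents; the assumption \<open>\<alpha> i < \<alpha> m + \<alpha> (i - m)\<close> therefore makes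
it negligible (\<open>cross_tail_tendsto_0\<close>).  On the first event the small summand is \<open>o (b i t)\<close> and
disappears in the limit, so that the limit measures of \<open>X\<close> and \<open>Y\<close> add up (\<open>MRV_add\<close>).  The theorem
follows by induction on the number of summands.

Three points need care.  The distance to \<open>CA (i - 1)\<close> is expressed by the number of entries above a
level (\<open>bounded_away_iff\<close>), which is what adds up in the argument above.  The scaling functions are
not assumed measurable, so the uniform convergence theorem and Potter's bounds do not apply;
since tail probabilities are monotone, regular variation along the powers of two is enough to bound
them by powers (\<open>MRV_tail_le_powr\<close>, \<open>MRV_tail_ge_powr\<close>).  Finally, test functions are uniformly
continuous only on bounded sets, so the mass near infinity is controlled by tightness
(\<open>MRV_tight\<close>).\<close>

section \<open>Order statistics and the number of large entries\<close>

definition num_ge :: "real \<Rightarrow> real ^ 'd \<Rightarrow> nat" where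
  "num_ge x z = card {j. x \<le> z $ j}"

text \<open>In a decreasing list an upward closed property holds exactly on an initial segment, whose length is
the number of elements that have the property.\<close>

lemma nth_rev_sorted_iff:
  fixes xs :: "'a::linorder list"
  assumes "sorted xs" "k < length xs" and up: "\<And>x y. x \<le> y \<Longrightarrow> P x \<Longrightarrow> P y"
  shows "P (rev xs ! k) \<longleftrightarrow> k < length (filter P xs)"
proof -
  have s: "rev xs ! l \<le> rev xs ! m" if "m \<le> l" "l < length xs" for l m
    using that assms(1) by (simp add: rev_nth sorted_iff_nth_mono)
  have initial: "takeWhile P ys = filter P ys" if "sorted_wrt (\<ge>) ys" for ys
    using that
  proof (induction ys)
    case (Cons y ys)
    have "\<not> P y \<Longrightarrow> filter P ys = []"
      using Cons.prems up by (auto simp: filter_empty_conv)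
    with Cons show ?case by simp
  qed simp
  have tw: "takeWhile P (rev xs) = filter P (rev xs)"
    by (rule initial) (use assms(1) in \<open>simp add: sorted_wrt_rev\<close>)
  show ?thesis
  proof
    assume "P (rev xs ! k)"
    then have "\<forall>m\<le>k. P (rev xs ! m)" using s up assms(2) by blast
    then have "k < length (takeWhile P (rev xs))"
      using assms(2) by (metis length_rev length_takeWhile_le linorder_not_less nth_length_takeWhile order_le_less_trans)
    then show "k < length (filter P xs)" unfolding tw by (simp add: rev_filter[symmetric])
  next
    assume "k < length (filter P xs)"
    then have "k < length (takeWhile P (rev xs))" unfolding tw by (simp add: rev_filter[symmetric])
    then show "P (rev xs ! k)" by (metis nth_mem set_takeWhileD takeWhile_nth)
  qed
qed

text \<open>Applied to the properties \<open>\<lambda>x. 0 \<le> x\<close> and \<open>\<lambda>x. 0 < x\<close>, this trades order statistics for cardinalities.\<close>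

lemma order_stat_iff:
  fixes z :: "real ^ 'd"
  assumes "1 \<le> i" "i \<le> CARD('d)" and up: "\<And>x y. x \<le> y \<Longrightarrow> P x \<Longrightarrow> P y"
  shows "P (order_stat i z) \<longleftrightarrow> i \<le> card {j. P (z $ j)}"
proof -
  define M where "M = image_mset (\<lambda>j. z $ j) (mset_set UNIV)"
  let ?xs = "sorted_list_of_multiset M"
  have len: "length ?xs = CARD('d)"
    by (metis M_def mset_sorted_list_of_multiset size_image_mset size_mset size_mset_set)
  have "length (filter P ?xs) = size (filter_mset P M)"
    by (metis mset_filter mset_sorted_list_of_multiset size_mset)
  also have "\<dots> = card {j. P (z $ j)}"
    by (simp add: M_def filter_mset_image_mset filter_mset_mset_set)
  finally have "length (filter P ?xs) = card {j. P (z $ j)}" .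
  moreover have "P (rev ?xs ! (i - 1)) \<longleftrightarrow> i - 1 < length (filter P ?xs)"
    by (rule nth_rev_sorted_iff) (use assms len in auto)
  ultimately show ?thesis using assms(1) by (auto simp: order_stat_def M_def)
qed

lemma num_ge_antimono: "x \<le> y \<Longrightarrow> num_ge y z \<le> num_ge x z"
  unfolding num_ge_def by (rule card_mono) auto

lemma num_ge_scale: "s > 0 \<Longrightarrow> num_ge x (z /\<^sub>R s) = num_ge (x * s) z"
  by (simp add: num_ge_def divide_simps mult.commute)

lemma mem_CA_iff:
  fixes z :: "real ^ 'd"
  assumes "1 \<le> i" "i \<le> CARD('d)"
  shows "z \<in> CA (i - 1) \<longleftrightarrow> z \<in> nonneg_orthant \<and> card {j. 0 < z $ j} < i"
proof -
  have "z \<in> nonneg_orthant \<Longrightarrow> 0 \<le> order_stat i z"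
    using order_stat_iff[OF assms, of "\<lambda>x. 0 \<le> x" z] assms by (auto simp: nonneg_orthant_def)
  moreover have "0 < order_stat i z \<longleftrightarrow> i \<le> card {j. 0 < z $ j}"
    by (rule order_stat_iff[OF assms]) auto
  ultimately show ?thesis using assms by (auto simp: CA_def)
qed

lemma mem_EE_iff:
  fixes z :: "real ^ 'd"
  assumes "1 \<le> i" "i \<le> CARD('d)"
  shows "z \<in> EE i \<longleftrightarrow> z \<in> nonneg_orthant \<and> i \<le> card {j. 0 < z $ j}"
  using mem_CA_iff[OF assms, of z] by (auto simp: EE_def)

lemma num_ge_imp_pos: "0 < x \<Longrightarrow> i \<le> num_ge x z \<Longrightarrow> i \<le> card {j. 0 < z $ j}"
  unfolding num_ge_def by (erule order_trans) (rule card_mono, auto)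

text \<open>A point of the cone has some distance from the removed set: its finitely many positive entries
exceed a common positive bound.  Hence \<open>EE i\<close> is a countable union of sets bounded away from
\<open>CA (i - 1)\<close>.\<close>

lemma EE_imp_num_ge:
  fixes z :: "real ^ 'd"
  assumes "i \<le> card {j. 0 < z $ j}"
  shows "\<exists>k. i \<le> num_ge (1 / Suc k) z"
proof -
  let ?A = "{j. 0 < z $ j}"
  have "\<forall>\<^sub>F k in sequentially. \<forall>j\<in>?A. 1 / Suc k \<le> z $ j"
  proof (subst eventually_ball_finite_distrib)
    show "\<forall>j\<in>?A. \<forall>\<^sub>F k in sequentially. 1 / real (Suc k) \<le> z $ j"
    proof
      fix j assume "j \<in> ?A"
      then have "\<forall>\<^sub>F k in sequentially. 1 / real (Suc k) < z $ j"
        by (intro order_tendstoD(2)[OF LIMSEQ_Suc[OF lim_1_over_n]]) auto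
      then show "\<forall>\<^sub>F k in sequentially. 1 / real (Suc k) \<le> z $ j"
        by eventually_elim simp
    qed
  qed simp
  then obtain k where "\<forall>j\<in>?A. 1 / Suc k \<le> z $ j"
    by (metis (no_types, lifting) eventually_sequentially order_refl)
  then have "card ?A \<le> num_ge (1 / Suc k) z" unfolding num_ge_def by (intro card_mono) auto
  with assms show ?thesis by (metis order_trans)
qed

text \<open>Replacing all but the \<open>i - 1\<close> largest entries of \<open>z\<close> by zero gives a nearest point of \<open>CA (i - 1)\<close>, so
the distance of \<open>z\<close> from this set is the \<open>i\<close>-th largest entry.  Counting entries above a level is
additive in a way that order statistics are not, which is why every support condition is used in
this form from here on.\<close>

lemma bounded_away_iff:
  fixes A :: "(real ^ 'd) set"
  assumes i: "1 \<le> i" "i \<le> CARD('d)" and A: "A \<subseteq> nonneg_orthant"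
  shows "bounded_away A (CA (i - 1)) \<longleftrightarrow> (\<exists>\<epsilon>>0. \<forall>z\<in>A. i \<le> num_ge \<epsilon> z)"
proof
  assume "bounded_away A (CA (i - 1))"
  then obtain \<epsilon> where e: "\<epsilon> > 0" "\<And>z y. z \<in> A \<Longrightarrow> y \<in> CA (i - 1) \<Longrightarrow> \<epsilon> \<le> infnorm (z - y)"
    unfolding bounded_away_def by auto
  have "i \<le> num_ge (\<epsilon> / 2) z" if z: "z \<in> A" for z
  proof (rule ccontr)
    assume less: "\<not> i \<le> num_ge (\<epsilon> / 2) z"
    \<comment> \<open>Dropping the entries below \<open>\<epsilon> / 2\<close> moves \<open>z\<close> into \<open>CA (i - 1)\<close> at a cost below \<open>\<epsilon>\<close>.\<close>
    define y :: "real ^ 'd" where "y = (\<chi> j. if \<epsilon> / 2 \<le> z $ j then z $ j else 0)"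
    have z0: "0 \<le> z $ j" for j using z A by (auto simp: nonneg_orthant_def)
    have "{j. 0 < y $ j} = {j. \<epsilon> / 2 \<le> z $ j}" using e(1) by (auto simp: y_def)
    moreover have "y \<in> nonneg_orthant" using z0 by (simp add: nonneg_orthant_def y_def)
    ultimately have "y \<in> CA (i - 1)" using less by (subst mem_CA_iff[OF i]) (simp add: num_ge_def)
    moreover have "infnorm (z - y) \<le> \<epsilon> / 2"
      unfolding infnorm_cart
    proof (rule cSup_least)
      show "r \<le> \<epsilon> / 2" if "r \<in> {\<bar>(z - y) $ j\<bar> |j. j \<in> UNIV}" for r
        using that z0 e(1) by (auto simp: y_def)
    qed blast
    ultimately show False using e z by fastforce
  qed
  then show "\<exists>\<epsilon>>0. \<forall>z\<in>A. i \<le> num_ge \<epsilon> z" using e(1) half_gt_zero by blast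
next
  assume "\<exists>\<epsilon>>0. \<forall>z\<in>A. i \<le> num_ge \<epsilon> z"
  then obtain \<epsilon> where e: "\<epsilon> > 0" "\<And>z. z \<in> A \<Longrightarrow> i \<le> num_ge \<epsilon> z" by auto
  have "\<epsilon> \<le> infnorm (z - y)" if z: "z \<in> A" and y: "y \<in> CA (i - 1)" for z y
  proof -
    have "card {j. 0 < y $ j} < card {j. \<epsilon> \<le> z $ j}" "y \<in> nonneg_orthant"
      using e(2)[OF z] y unfolding mem_CA_iff[OF i] num_ge_def by linarith+
    then have "\<not> {j. \<epsilon> \<le> z $ j} \<subseteq> {j. 0 < y $ j}" 
      by (metis card_mono finite linorder_not_less)
    then obtain j where "\<epsilon> \<le> z $ j" "\<not> 0 < y $ j" by auto
    then have "\<epsilon> \<le> \<bar>(z - y) $ j\<bar>" by simp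
    also have "\<dots> \<le> infnorm (z - y)" by (rule component_le_infnorm_cart)
    finally show ?thesis .
  qed
  then show "bounded_away A (CA (i - 1))" using e(1) unfolding bounded_away_def by blast
qed

text \<open>Written this way, a counting set inherits openness or closedness from the sets \<open>{z. P (z $ j)}\<close>.\<close>

lemma level_set_eq: "{z. i \<le> card {j. P (z $ j)}} = (\<Union>A\<in>{A. i \<le> card A}. \<Inter>j\<in>A. {z::real^'d. P (z $ j)})"
proof -
  have "i \<le> card {j. P (z $ j)}" if "i \<le> card A" "\<forall>j\<in>A. P (z $ j)" for A and z :: "real^'d"
    by (rule order_trans[OF that(1)], rule card_mono) (use that in auto)
  then show ?thesis by auto
qed

lemma closed_num_ge: "closed {z :: real ^ 'd. i \<le> num_ge x z}"
  unfolding num_ge_def level_set_eq by (intro closed_UN closed_INT ballI closed_Collect_le) (auto intro: continuous_intros)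

lemma open_num_pos: "open {z :: real ^ 'd. i \<le> card {j. 0 < z $ j}}"
  unfolding level_set_eq by (intro open_UN open_INT ballI open_Collect_less) (auto intro: continuous_intros)

lemma closed_nonneg_orthant: "closed (nonneg_orthant :: (real ^ 'd) set)"
  unfolding nonneg_orthant_def by (intro closed_Collect_all closed_Collect_le) (auto intro: continuous_intros)

lemma EE_eq:
  assumes "1 \<le> i" "i \<le> CARD('d)"
  shows "(EE i :: (real ^ 'd) set) = nonneg_orthant \<inter> {z. i \<le> card {j. 0 < z $ j}}"
  using mem_EE_iff[OF assms] by blast

lemma sets_EE:
  assumes "1 \<le> i" "i \<le> CARD('d)"
  shows "(EE i :: (real ^ 'd) set) \<in> sets borel"
  unfolding EE_eq[OF assms] by (intro sets.Int borel_closed borel_open closed_nonneg_orthant open_num_pos)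

section \<open>Continuous test functions\<close>

definition clamp01 :: "real \<Rightarrow> real" where "clamp01 x = max 0 (min 1 x)"

text \<open>A continuous substitute for the indicator of \<open>{z. i \<le> num_ge \<delta> z}\<close>: the inner sum counts the entries
above \<open>\<delta>\<close>, with a linear transition between \<open>\<delta> / 2\<close> and \<open>\<delta>\<close>, so it is at least \<open>i\<close> if \<open>i\<close> entries
reach \<open>\<delta>\<close> and at most \<open>i - 1\<close> if fewer than \<open>i\<close> entries reach \<open>\<delta> / 2\<close>.\<close>

definition bump :: "nat \<Rightarrow> real \<Rightarrow> real ^ 'd \<Rightarrow> real" where
  "bump i \<delta> z = clamp01 ((\<Sum>j\<in>UNIV. clamp01 (2 * (z $ j) / \<delta> - 1)) - (real i - 1))"

lemma clamp01_bounds: "0 \<le> clamp01 x" "clamp01 x \<le> 1" by (auto simp: clamp01_def)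

lemma bump_bounds: "0 \<le> bump i \<delta> z" "bump i \<delta> z \<le> 1" by (auto simp: bump_def clamp01_bounds)

lemma continuous_bump: "0 < \<delta> \<Longrightarrow> continuous_on S (bump i \<delta>)"
  unfolding bump_def clamp01_def by (intro continuous_intros) auto

lemma bump_eq_1: assumes "\<delta> > 0" "i \<le> num_ge \<delta> z" shows "bump i \<delta> z = 1"
proof -
  have "real i \<le> real (num_ge \<delta> z)" using assms by simp
  also have "\<dots> = (\<Sum>j\<in>{j. \<delta> \<le> z $ j}. 1)" by (simp add: num_ge_def)
  also have "\<dots> \<le> (\<Sum>j\<in>{j. \<delta> \<le> z $ j}. clamp01 (2 * (z $ j) / \<delta> - 1))"
    using assms(1) by (intro sum_mono) (auto simp: clamp01_def divide_simps)
  also have "\<dots> \<le> (\<Sum>j\<in>UNIV. clamp01 (2 * (z $ j) / \<delta> - 1))"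
    by (rule sum_mono2) (auto simp: clamp01_bounds)
  finally show ?thesis unfolding bump_def by (simp add: clamp01_def)
qed

lemma bump_nonzeroD: assumes "\<delta> > 0" "bump i \<delta> z \<noteq> 0" shows "i \<le> num_ge (\<delta> / 2) z"
proof (rule ccontr)
  assume "\<not> i \<le> num_ge (\<delta> / 2) z"
  have "(\<Sum>j\<in>UNIV. clamp01 (2 * (z $ j) / \<delta> - 1)) = (\<Sum>j\<in>{j. \<delta> / 2 \<le> z $ j}. clamp01 (2 * (z $ j) / \<delta> - 1))"
    using assms(1) by (intro sum.mono_neutral_right) (auto simp: clamp01_def divide_simps not_le)
  also have "\<dots> \<le> (\<Sum>j\<in>{j. \<delta> / 2 \<le> z $ j}. 1)"
    by (intro sum_mono clamp01_bounds)
  also have "\<dots> = real (num_ge (\<delta> / 2) z)" by (simp add: num_ge_def)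
  also have "\<dots> \<le> real i - 1" using \<open>\<not> i \<le> num_ge (\<delta> / 2) z\<close> by simp
  finally have "bump i \<delta> z = 0" by (simp add: bump_def clamp01_def)
  with assms show False by simp
qed

lemma MM_test_functionI:
  fixes f :: "real ^ 'd \<Rightarrow> real"
  assumes i: "1 \<le> i" "i \<le> CARD('d)" and "continuous_on (EE i) f" 
    and "\<And>z. z \<in> EE i \<Longrightarrow> \<bar>f z\<bar> \<le> B" and e: "\<epsilon> > 0"
    and supp: "\<And>z. z \<in> EE i \<Longrightarrow> f z \<noteq> 0 \<Longrightarrow> i \<le> num_ge \<epsilon> z"
  shows "MM_test_function i f"
proof -
  have "closure {x \<in> EE i. f x \<noteq> 0} \<subseteq> {z. i \<le> num_ge \<epsilon> z}"
    using closed_num_ge supp by (intro closure_minimal) auto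
  moreover have "EE i \<subseteq> (nonneg_orthant :: (real^'d) set)" unfolding EE_def by auto
  ultimately have "bounded_away (EE i \<inter> closure {x \<in> EE i. f x \<noteq> 0}) (CA (i - 1))"
    using e by (subst bounded_away_iff[OF i]) blast+
  then show ?thesis unfolding MM_test_function_def using assms(3,4) by (auto simp: bounded_iff)
qed

lemma MM_test_functionE:
  fixes f :: "real ^ 'd \<Rightarrow> real"
  assumes i: "1 \<le> i" "i \<le> CARD('d)" and f: "MM_test_function i f"
  obtains B \<epsilon> where "\<epsilon> > 0" "B > 0" "\<And>z. z \<in> EE i \<Longrightarrow> \<bar>f z\<bar> \<le> B"
    "\<And>z. z \<in> EE i \<Longrightarrow> f z \<noteq> 0 \<Longrightarrow> i \<le> num_ge \<epsilon> z"
proof -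
  have "EE i \<subseteq> (nonneg_orthant :: (real^'d) set)" unfolding EE_def by auto
  then have "\<exists>\<epsilon>>0. \<forall>z\<in>EE i \<inter> closure {x \<in> EE i. f x \<noteq> 0}. i \<le> num_ge \<epsilon> z"
    using f by (subst bounded_away_iff[OF i, symmetric]) (auto simp: MM_test_function_def)
  then obtain \<epsilon> where e: "\<epsilon> > 0" "\<And>z. z \<in> EE i \<Longrightarrow> f z \<noteq> 0 \<Longrightarrow> i \<le> num_ge \<epsilon> z"
    using closure_subset[of "{x \<in> EE i. f x \<noteq> 0}"] by blast
  moreover obtain B where "B > 0" "\<And>z. z \<in> EE i \<Longrightarrow> \<bar>f z\<bar> \<le> B"
    using f unfolding MM_test_function_def bounded_pos by auto
  ultimately show thesis using that by blast
qed

text \<open>Test functions are meaningful on the cone only.  Their extension by zero lets them be evaluated at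
vectors that lie outside the cone, such as \<open>X\<close> and \<open>Y\<close> when only \<open>X + Y\<close> has enough positive entries.\<close>

definition zero_ext :: "nat \<Rightarrow> (real ^ 'd \<Rightarrow> real) \<Rightarrow> real ^ 'd \<Rightarrow> real" where
  "zero_ext i f z = indicator (EE i) z * f z"

text \<open>No jump occurs at the boundary of the cone, because \<open>f\<close> already vanishes near it: the orthant is the
union of two relatively open sets, the cone and the set of points with fewer than \<open>i\<close> entries above
\<open>\<epsilon>\<close>, and \<open>f\<close> is zero on their overlap.\<close>

lemma continuous_on_zero_ext:
  fixes f :: "real ^ 'd \<Rightarrow> real"
  assumes i: "1 \<le> i" "i \<le> CARD('d)" and f: "MM_test_function i f"
  shows "continuous_on nonneg_orthant (zero_ext i f)"
proof -
  obtain B \<epsilon> where e: "\<epsilon> > 0" "\<And>z. z \<in> EE i \<Longrightarrow> f z \<noteq> 0 \<Longrightarrow> i \<le> num_ge \<epsilon> z"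
    using MM_test_functionE[OF i f] by metis
  define N where "N = nonneg_orthant \<inter> - {z :: real^'d. i \<le> num_ge \<epsilon> z}"
  have "z \<in> EE i \<union> N" if "z \<in> nonneg_orthant" for z
    using that num_ge_imp_pos[OF e(1), of i z] by (auto simp: EE_eq[OF i] N_def)
  then have U: "nonneg_orthant = EE i \<union> N" by (auto simp: EE_eq[OF i] N_def)
  have "continuous_on (EE i \<union> N) (zero_ext i f)"
  proof (rule continuous_on_Un_local_open)
    show "openin (top_of_set (EE i \<union> N)) (EE i)"
      using openin_open_Int[OF open_num_pos, of nonneg_orthant i]
      unfolding U[symmetric] unfolding EE_eq[OF i] .
    show "openin (top_of_set (EE i \<union> N)) N"
      using openin_open_Int[of "- {z :: real^'d. i \<le> num_ge \<epsilon> z}" nonneg_orthant]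
      unfolding U[symmetric] unfolding N_def using closed_num_ge open_Compl by blast
    show "continuous_on (EE i) (zero_ext i f)"
      using f by (subst continuous_on_cong[OF refl, where g=f]) (auto simp: MM_test_function_def zero_ext_def)
    have "zero_ext i f z = 0" if "z \<in> N" for z using e(2) that by (auto simp: N_def zero_ext_def indicator_def)
    then show "continuous_on N (zero_ext i f)"
      by (subst continuous_on_cong[OF refl, where g="\<lambda>_. 0"]) auto
  qed
  then show ?thesis unfolding U .
qed

section \<open>Expectations and tail probabilities on the scale of regular variation\<close>

lemma bump_test_function:
  assumes "1 \<le> i" "i \<le> CARD('d)" "0 < \<delta>"
  shows "MM_test_function i (bump i \<delta> :: real ^ 'd \<Rightarrow> real)"
proof (rule MM_test_functionI[OF assms(1,2) continuous_bump[OF assms(3)], where \<epsilon> = "\<delta> / 2" and B = 1])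
  show "\<bar>bump i \<delta> z\<bar> \<le> 1" for z :: "real ^ 'd" using bump_bounds[of i \<delta> z] by simp
qed (use assms bump_nonzeroD in auto)

lemma borel_measurable_zero_ext:
  assumes "1 \<le> i" "i \<le> CARD('d)" "MM_test_function i (f :: real ^ 'd \<Rightarrow> real)"
  shows "zero_ext i f \<in> borel_measurable borel"
  using borel_measurable_continuous_on_indicator[OF sets_EE[OF assms(1,2)], of f] assms(3)
  by (simp add: zero_ext_def[abs_def] MM_test_function_def)

lemma scale_measure_eq_density: "scale_measure r M = density M (\<lambda>_. r)"
  by (rule measure_eqI) (auto simp: emeasure_density_const)

lemma integral_scale_measure:
  fixes f :: "'a \<Rightarrow> real"
  assumes "0 \<le> r" "f \<in> borel_measurable M"
  shows "integral\<^sup>L (scale_measure (ennreal r) M) f = r * integral\<^sup>L M f"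
  unfolding scale_measure_eq_density using assms by (subst integral_density) auto

lemma integral_scaled_law:
  fixes X :: "'a \<Rightarrow> real ^ 'd"
  assumes i: "1 \<le> i" "i \<le> CARD('d)" and f: "MM_test_function i f" and "0 \<le> t"
    and X: "X \<in> borel_measurable P"
  shows "integral\<^sup>L (scaled_law i P X t s) f = t * (\<integral>\<omega>. zero_ext i f (X \<omega> /\<^sub>R s) \<partial>P)"
proof -
  have "f \<in> borel_measurable (restrict_space (distr P borel (\<lambda>\<omega>. X \<omega> /\<^sub>R s)) (EE i))"
    using borel_measurable_zero_ext[OF i f]
    by (subst borel_measurable_restrict_space_iff) (auto simp: sets_EE[OF i] zero_ext_def[abs_def])
  then have "integral\<^sup>L (scaled_law i P X t s) f
      = t * integral\<^sup>L (restrict_space (distr P borel (\<lambda>\<omega>. X \<omega> /\<^sub>R s)) (EE i)) f"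
    unfolding scaled_law_def using \<open>0 \<le> t\<close> by (intro integral_scale_measure)
  also have "integral\<^sup>L (restrict_space (distr P borel (\<lambda>\<omega>. X \<omega> /\<^sub>R s)) (EE i)) f
      = integral\<^sup>L (distr P borel (\<lambda>\<omega>. X \<omega> /\<^sub>R s)) (zero_ext i f)"
    by (subst integral_restrict_space) (auto simp: sets_EE[OF i] zero_ext_def[abs_def])
  also have "\<dots> = (\<integral>\<omega>. zero_ext i f (X \<omega> /\<^sub>R s) \<partial>P)"
    by (rule integral_distr) (use X borel_measurable_zero_ext[OF i f] in auto)
  finally show ?thesis .
qed

lemma integrable_zero_ext:
  fixes X :: "'a \<Rightarrow> real ^ 'd"
  assumes "prob_space P" and i: "1 \<le> i" "i \<le> CARD('d)" and f: "MM_test_function i f"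
    and X: "X \<in> borel_measurable P"
  shows "integrable P (\<lambda>\<omega>. zero_ext i f (X \<omega> /\<^sub>R s))"
proof -
  interpret prob_space P by fact
  obtain B where B: "B > 0" "\<And>z. z \<in> EE i \<Longrightarrow> \<bar>f z\<bar> \<le> B"
    using MM_test_functionE[OF i f] by metis
  have "(\<lambda>\<omega>. zero_ext i f (X \<omega> /\<^sub>R s)) \<in> borel_measurable P"
    using measurable_compose[OF _ borel_measurable_zero_ext[OF i f], of "\<lambda>\<omega>. X \<omega> /\<^sub>R s" P] X by simp
  moreover have "\<bar>zero_ext i f z\<bar> \<le> B" for z
    using B by (auto simp: zero_ext_def indicator_def)
  ultimately show ?thesis by (intro integrable_const_bound[of _ B]) auto
qed

text \<open>The value \<open>x = 1\<close> in the definition of regular variation rules out zeros for large arguments, where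
the quotient would be \<open>0 / 0 = 0\<close>.\<close>

lemma regularly_varying_pos:
  assumes "regularly_varying \<beta> b" shows "\<forall>\<^sub>F t in at_top. 0 < b t"
proof -
  have "((\<lambda>t. b (t * 1) / b t) \<longlongrightarrow> 1 powr \<beta>) at_top"
    using assms unfolding regularly_varying_def by (metis zero_less_one)
  then have "\<forall>\<^sub>F t in at_top. 0 < b (t * 1) / b t"
    by (rule order_tendstoD) simp
  moreover have "\<forall>\<^sub>F t in at_top. (0::real) \<le> t" by (rule eventually_ge_at_top)
  ultimately show ?thesis
    by eventually_elim (use assms in \<open>auto simp: regularly_varying_def divide_simps split: if_splits\<close>)
qed

text \<open>Vague convergence on the cone, stated in terms of expectations of the vector itself.\<close>

lemma MRV_tendsto:
  fixes X :: "'a \<Rightarrow> real ^ 'd"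
  assumes i: "1 \<le> i" "i \<le> CARD('d)" and X: "MRV P X \<alpha> b \<mu> i" and f: "MM_test_function i f"
  shows "((\<lambda>t. t * (\<integral>\<omega>. zero_ext i f (X \<omega> /\<^sub>R b t) \<partial>P)) \<longlongrightarrow> integral\<^sup>L \<mu> f) at_top"
proof (rule Lim_transform_eventually)
  show "((\<lambda>t. integral\<^sup>L (scaled_law i P X t (b t)) f) \<longlongrightarrow> integral\<^sup>L \<mu> f) at_top"
    using X f unfolding MRV_def MM_converges_def by blast
  have "X \<in> borel_measurable P" using X unfolding MRV_def by blast
  show "\<forall>\<^sub>F t in at_top. integral\<^sup>L (scaled_law i P X t (b t)) f = t * (\<integral>\<omega>. zero_ext i f (X \<omega> /\<^sub>R b t) \<partial>P)"
    using eventually_ge_at_top[of 0] 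
    by eventually_elim (rule integral_scaled_law[OF i f _ \<open>X \<in> borel_measurable P\<close>])
qed

definition tail_prob :: "'a measure \<Rightarrow> ('a \<Rightarrow> real ^ 'd) \<Rightarrow> nat \<Rightarrow> real \<Rightarrow> real" where
  "tail_prob P X i x = measure P {\<omega> \<in> space P. i \<le> num_ge x (X \<omega>)}"

lemma sets_tail [measurable]:
  fixes X :: "'a \<Rightarrow> real ^ 'd"
  assumes "X \<in> borel_measurable P"
  shows "{\<omega> \<in> space P. i \<le> num_ge x (X \<omega>)} \<in> sets P"
  using measurable_sets[OF assms borel_closed[OF closed_num_ge[of i x]]]
  by (simp add: vimage_def Int_def conj_commute)

lemma tail_antimono:
  assumes "prob_space P" "X \<in> borel_measurable P" "x \<le> y"
  shows "tail_prob P X i y \<le> tail_prob P X i x"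
proof -
  interpret prob_space P by fact
  show ?thesis unfolding tail_prob_def
    by (rule finite_measure_mono) (use num_ge_antimono[OF assms(3)] sets_tail[OF assms(2)] in \<open>auto intro: order_trans\<close>)
qed

lemma tail_nonneg: "0 \<le> tail_prob P X i x" by (simp add: tail_prob_def)

text \<open>The upper half of the portmanteau theorem: \<open>f\<close> dominates the indicator of the event.  The level \<open>\<delta>\<close>
is arbitrary; it only ensures that the scaled vector lies in the cone.\<close>

lemma MRV_eventually_prob_le:
  fixes X :: "'a \<Rightarrow> real ^ 'd"
  assumes P: "prob_space P" and i: "1 \<le> i" "i \<le> CARD('d)" and X: "MRV P X \<alpha> b \<mu> i"
    and f: "MM_test_function i f" "f \<in> borel_measurable borel" "\<And>z. 0 \<le> f z"
    and less: "integral\<^sup>L \<mu> f < C" and \<delta>: "0 < \<delta>"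
  shows "\<forall>\<^sub>F t in at_top.
    t * measure P {\<omega> \<in> space P. i \<le> num_ge (\<delta> * b t) (X \<omega>) \<and> 1 \<le> f (X \<omega> /\<^sub>R b t)} \<le> C"
proof -
  interpret prob_space P by fact
  have Xm[measurable]: "X \<in> borel_measurable P" and b: "regularly_varying (1/\<alpha>) b"
    and Xn: "\<And>\<omega>. \<omega> \<in> space P \<Longrightarrow> X \<omega> \<in> nonneg_orthant" using X by (auto simp: MRV_def)
  note f(2)[measurable]
  have "\<forall>\<^sub>F t in at_top. t * (\<integral>\<omega>. zero_ext i f (X \<omega> /\<^sub>R b t) \<partial>P) < C"
    by (rule order_tendstoD(2)[OF MRV_tendsto[OF i X f(1)] less])
  with eventually_ge_at_top[of 0] regularly_varying_pos[OF b] show ?thesis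
  proof eventually_elim
    case (elim t)
    let ?S = "{\<omega> \<in> space P. i \<le> num_ge (\<delta> * b t) (X \<omega>) \<and> 1 \<le> f (X \<omega> /\<^sub>R b t)}"
    have "?S = {\<omega> \<in> space P. i \<le> num_ge (\<delta> * b t) (X \<omega>)} \<inter> {\<omega> \<in> space P. 1 \<le> f (X \<omega> /\<^sub>R b t)}"
      by blast
    also have "\<dots> \<in> sets P" using sets_tail[OF Xm] by (intro sets.Int) measurable
    finally have S: "?S \<in> sets P" .
    have "measure P ?S = (\<integral>\<omega>. indicator ?S \<omega> \<partial>P)" using S by simp
    also have "\<dots> \<le> (\<integral>\<omega>. zero_ext i f (X \<omega> /\<^sub>R b t) \<partial>P)"
    proof (rule integral_mono[OF _ integrable_zero_ext[OF P i f(1) Xm]])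
      show "integrable P (indicat_real ?S)"
        using S by (simp add: integrable_indicator_iff less_top[symmetric])
      fix \<omega> assume w: "\<omega> \<in> space P"
      have "X \<omega> /\<^sub>R b t \<in> EE i" if "i \<le> num_ge (\<delta> * b t) (X \<omega>)"
      proof -
        have "i \<le> num_ge \<delta> (X \<omega> /\<^sub>R b t)" using that elim by (simp add: num_ge_scale)
        then have "i \<le> card {j. 0 < (X \<omega> /\<^sub>R b t) $ j}" using num_ge_imp_pos[OF \<delta>] by blast
        moreover have "X \<omega> /\<^sub>R b t \<in> nonneg_orthant" using Xn[OF w] elim by (simp add: nonneg_orthant_def)
        ultimately show ?thesis by (simp add: EE_eq[OF i])
      qed
      then show "indicat_real ?S \<omega> \<le> zero_ext i f (X \<omega> /\<^sub>R b t)"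
        using f(3) by (auto simp: zero_ext_def indicator_def)
    qed
    finally have "t * measure P ?S \<le> t * (\<integral>\<omega>. zero_ext i f (X \<omega> /\<^sub>R b t) \<partial>P)"
      using elim by (intro mult_left_mono)
    with elim show ?case by linarith
  qed
qed

lemma borel_measurable_bump: "0 < \<delta> \<Longrightarrow> bump i \<delta> \<in> borel_measurable borel"
  by (intro borel_measurable_continuous_onI continuous_bump)

lemma MRV_tail_upper:
  fixes X :: "'a \<Rightarrow> real ^ 'd"
  assumes P: "prob_space P" and i: "1 \<le> i" "i \<le> CARD('d)" and X: "MRV P X \<alpha> b \<mu> i" and \<delta>: "0 < \<delta>"
  obtains C where "C > 0" "\<forall>\<^sub>F t in at_top. t * tail_prob P X i (\<delta> * b t) \<le> C"
proof -
  let ?f = "bump i \<delta> :: real ^ 'd \<Rightarrow> real"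
  let ?C = "\<bar>integral\<^sup>L \<mu> ?f\<bar> + 1"
  have b: "regularly_varying (1/\<alpha>) b" using X by (simp add: MRV_def)
  have "\<forall>\<^sub>F t in at_top.
    t * measure P {\<omega> \<in> space P. i \<le> num_ge (\<delta> * b t) (X \<omega>) \<and> 1 \<le> ?f (X \<omega> /\<^sub>R b t)} \<le> ?C"
    by (rule MRV_eventually_prob_le[OF P i X bump_test_function[OF i \<delta>] borel_measurable_bump[OF \<delta>] bump_bounds(1) _ \<delta>])
      simp
  with regularly_varying_pos[OF b]
  have "\<forall>\<^sub>F t in at_top. t * tail_prob P X i (\<delta> * b t) \<le> ?C"
  proof eventually_elim
    case (elim t)
    have "1 \<le> ?f (X \<omega> /\<^sub>R b t)" if "i \<le> num_ge (\<delta> * b t) (X \<omega>)" for \<omega>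
      using bump_eq_1[OF \<delta>, of i "X \<omega> /\<^sub>R b t"] that elim by (simp add: num_ge_scale)
    then show ?case using elim by (simp add: tail_prob_def cong: conj_cong)
  qed
  then show thesis using that[of ?C] by simp
qed

lemma MM_level_set:
  assumes i: "1 \<le> i" "i \<le> CARD('d)" and \<mu>: "(\<mu> :: (real ^ 'd) measure) \<in> MM i" and "0 < \<delta>"
  shows "{z \<in> EE i. i \<le> num_ge \<delta> z} \<in> sets \<mu>" "emeasure \<mu> {z \<in> EE i. i \<le> num_ge \<delta> z} < \<infinity>"
proof -
  have "sets \<mu> = sets (restrict_space borel (EE i))" using \<mu> by (simp add: MM_def)
  then show s: "{z \<in> EE i. i \<le> num_ge \<delta> z} \<in> sets \<mu>"
    using borel_closed[OF closed_num_ge[of i \<delta>]] by (auto simp: sets_restrict_space)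
  have "bounded_away {z \<in> EE i :: (real ^ 'd) set. i \<le> num_ge \<delta> z} (CA (i - 1))"
    by (subst bounded_away_iff[OF i]) (use \<open>0 < \<delta>\<close> in \<open>auto simp: EE_def\<close>)
  with s \<mu> show "emeasure \<mu> {z \<in> EE i. i \<le> num_ge \<delta> z} < \<infinity>" by (auto simp: MM_def)
qed

lemma MM_integrable_test:
  assumes i: "1 \<le> i" "i \<le> CARD('d)" and \<mu>: "(\<mu> :: (real ^ 'd) measure) \<in> MM i"
    and f: "MM_test_function i f"
  shows "integrable \<mu> f"
proof -
  obtain B \<epsilon> where e: "\<epsilon> > 0" "B > 0" "\<And>z. z \<in> EE i \<Longrightarrow> \<bar>f z\<bar> \<le> B"
    "\<And>z. z \<in> EE i \<Longrightarrow> f z \<noteq> 0 \<Longrightarrow> i \<le> num_ge \<epsilon> z"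
    using MM_test_functionE[OF i f] by metis
  have s: "sets \<mu> = sets (restrict_space borel (EE i))" using \<mu> by (simp add: MM_def)
  have sp: "space \<mu> = EE i" using sets_eq_imp_space_eq[OF s] by (simp add: space_restrict_space)
  have "f \<in> borel_measurable (restrict_space borel (EE i))"
    using f by (intro borel_measurable_continuous_on_restrict) (simp add: MM_test_function_def)
  then have "f \<in> borel_measurable \<mu>" by (subst measurable_cong_sets[OF s refl])
  note m = MM_level_set[OF i \<mu> e(1)]
  have "integrable \<mu> (\<lambda>z. B * indicat_real {z \<in> EE i. i \<le> num_ge \<epsilon> z} z)"
    using m by (intro integrable_mult_right) (auto simp: integrable_indicator_iff)
  then show ?thesis
    by (rule Bochner_Integration.integrable_bound) (use e sp \<open>f \<in> borel_measurable \<mu>\<close> in \<open>auto simp: indicator_def\<close>)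
qed

text \<open>A non-null measure charges one of the countably many sets \<open>{z. i \<le> num_ge (1 / Suc k) z}\<close> that exhaust
the cone, and the bump function is one there.\<close>

lemma MM_nonnull_bump:
  assumes i: "1 \<le> i" "i \<le> CARD('d)" and \<mu>: "(\<mu> :: (real ^ 'd) measure) \<in> MM i"
    and nz: "emeasure \<mu> (space \<mu>) \<noteq> 0"
  obtains \<delta> where "\<delta> > 0" "integral\<^sup>L \<mu> (bump i \<delta>) > 0"
proof -
  have s: "sets \<mu> = sets (restrict_space borel (EE i))" using \<mu> by (simp add: MM_def)
  have sp: "space \<mu> = EE i" using sets_eq_imp_space_eq[OF s] by (simp add: space_restrict_space)
  let ?A = "\<lambda>k. {z \<in> EE i. i \<le> num_ge (1 / Suc k) z} :: (real ^ 'd) set"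
  have "EE i = (\<Union>k. ?A k)" using EE_imp_num_ge by (auto simp: EE_eq[OF i])
  with nz sp have "emeasure \<mu> (\<Union>k. ?A k) \<noteq> 0" by simp
  then obtain k where k: "emeasure \<mu> (?A k) \<noteq> 0"
    using emeasure_UN_eq_0[of \<mu> ?A] MM_level_set(1)[OF i \<mu>] by fastforce
  let ?d = "1 / real (Suc k)"
  have d: "?d > 0" by simp
  note m = MM_level_set[OF i \<mu> d]
  have "0 < measure \<mu> (?A k)" using k m(2)
    by (simp add: measure_def enn2real_positive_iff) (metis gr_zeroI)
  also have "\<dots> = integral\<^sup>L \<mu> (indicator (?A k))" using m sp by (simp add: Int_absorb2 sets.sets_into_space)
  also have "\<dots> \<le> integral\<^sup>L \<mu> (bump i ?d)"
  proof (rule integral_mono)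
    show "integrable \<mu> (indicat_real (?A k))" using m by (auto simp: integrable_indicator_iff)
    show "integrable \<mu> (bump i ?d)" by (rule MM_integrable_test[OF i \<mu> bump_test_function[OF i d]])
    show "indicat_real (?A k) z \<le> bump i ?d z" for z
      using bump_eq_1[OF d, of i z] bump_bounds[of i ?d z] by (auto simp: indicator_def)
  qed
  finally show thesis using that d by blast
qed

text \<open>Together with \<open>MRV_tail_upper\<close> this says that the tail probability at level \<open>b t\<close> is of exact order
\<open>1 / t\<close>.  Non-nullness of the limit measure enters here, and only provides some level \<open>\<delta>\<close>.\<close>

lemma MRV_tail_lower:
  fixes X :: "'a \<Rightarrow> real ^ 'd"
  assumes P: "prob_space P" and i: "1 \<le> i" "i \<le> CARD('d)" and X: "MRV P X \<alpha> b \<mu> i"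
  obtains \<delta> c where "\<delta> > 0" "c > 0" "\<forall>\<^sub>F t in at_top. c \<le> t * tail_prob P X i (\<delta> * b t)"
proof -
  interpret prob_space P by fact
  have Xm: "X \<in> borel_measurable P" and b: "regularly_varying (1/\<alpha>) b" and \<mu>: "\<mu> \<in> MM i" "emeasure \<mu> (space \<mu>) \<noteq> 0"
    and Xn: "\<And>\<omega>. \<omega> \<in> space P \<Longrightarrow> X \<omega> \<in> nonneg_orthant" using X by (auto simp: MRV_def)
  obtain \<delta> where \<delta>: "\<delta> > 0" and L: "integral\<^sup>L \<mu> (bump i \<delta>) > 0" using MM_nonnull_bump[OF i \<mu>] .
  let ?f = "bump i \<delta> :: real ^ 'd \<Rightarrow> real"
  let ?L = "integral\<^sup>L \<mu> ?f"
  note f = bump_test_function[OF i \<delta>]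
  have "\<forall>\<^sub>F t in at_top. ?L / 2 < t * (\<integral>\<omega>. zero_ext i ?f (X \<omega> /\<^sub>R b t) \<partial>P)"
    by (rule order_tendstoD(1)[OF MRV_tendsto[OF i X f]]) (use L in simp)
  with eventually_ge_at_top[of 0] regularly_varying_pos[OF b]
  have "\<forall>\<^sub>F t in at_top. ?L / 2 \<le> t * tail_prob P X i (\<delta> / 2 * b t)"
  proof eventually_elim
    case (elim t)
    let ?S = "{\<omega> \<in> space P. i \<le> num_ge (\<delta> / 2 * b t) (X \<omega>)}"
    have "(\<integral>\<omega>. zero_ext i ?f (X \<omega> /\<^sub>R b t) \<partial>P) \<le> (\<integral>\<omega>. indicator ?S \<omega> \<partial>P)"
    proof (rule integral_mono[OF integrable_zero_ext[OF P i f Xm]])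
      show "integrable P (indicat_real ?S)"
        using sets_tail[OF Xm] by (simp add: integrable_indicator_iff less_top[symmetric])
      fix \<omega> assume w: "\<omega> \<in> space P"
      have "i \<le> num_ge (\<delta> / 2 * b t) (X \<omega>)" if "?f (X \<omega> /\<^sub>R b t) \<noteq> 0"
        using bump_nonzeroD[OF \<delta> that] elim by (simp add: num_ge_scale)
      then show "zero_ext i ?f (X \<omega> /\<^sub>R b t) \<le> indicat_real ?S \<omega>"
        using bump_bounds[of i \<delta> "X \<omega> /\<^sub>R b t"] w by (auto simp: zero_ext_def indicator_def)
    qed
    also have "\<dots> = tail_prob P X i (\<delta> / 2 * b t)" unfolding tail_prob_def using sets_tail[OF Xm] by simp
    finally have "t * (\<integral>\<omega>. zero_ext i ?f (X \<omega> /\<^sub>R b t) \<partial>P) \<le> t * tail_prob P X i (\<delta> / 2 * b t)"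
      using elim by (intro mult_left_mono)
    with elim show ?case by linarith
  qed
  then show thesis using that[of "\<delta> / 2" "?L / 2"] L \<delta> by simp
qed

text \<open>Vague convergence on the cone ignores only the neighbourhood of \<open>CA (i - 1)\<close>; test functions may
live near infinity.  Testing against \<open>f k\<close>, a bump function that is made zero on the ball of radius \<open>k\<close>,
and letting \<open>k\<close> grow shows that no mass escapes to infinity, because the limit measure is finite away
from \<open>CA (i - 1)\<close>.\<close>

lemma MRV_tight:
  fixes X :: "'a \<Rightarrow> real ^ 'd"
  assumes P: "prob_space P" and i: "1 \<le> i" "i \<le> CARD('d)" and X: "MRV P X \<alpha> b \<mu> i"
    and \<delta>: "0 < \<delta>" and "0 < \<kappa>"
  obtains R where "\<forall>\<^sub>F t in at_top.
    t * measure P {\<omega> \<in> space P. i \<le> num_ge (\<delta> * b t) (X \<omega>) \<and> R \<le> norm (X \<omega> /\<^sub>R b t)} \<le> \<kappa>"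
proof -
  have \<mu>: "\<mu> \<in> MM i" and b: "regularly_varying (1/\<alpha>) b" using X by (simp_all add: MRV_def)
  define f :: "nat \<Rightarrow> real ^ 'd \<Rightarrow> real" where "f k z = bump i \<delta> z * clamp01 (norm z - real k)" for k z
  have f_bounds: "0 \<le> f k z" "f k z \<le> bump i \<delta> z" for k z
    using mult_left_mono[OF clamp01_bounds(2) bump_bounds(1)]
    by (auto simp: f_def bump_bounds clamp01_bounds)
  have f_cont: "continuous_on S (f k)" for k S
    unfolding f_def clamp01_def by (intro continuous_intros continuous_bump \<delta>)
  have f_test: "MM_test_function i (f k)" for k
  proof (rule MM_test_functionI[OF i f_cont, where B = 1 and \<epsilon> = "\<delta> / 2"])
    show "\<bar>f k z\<bar> \<le> 1" for z using f_bounds[of k z] bump_bounds(2)[of i \<delta> z] by simp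
    show "i \<le> num_ge (\<delta> / 2) z" if "f k z \<noteq> 0" for z
      using that bump_nonzeroD[OF \<delta>] by (auto simp: f_def)
  qed (use \<delta> in simp)
  have "(\<lambda>k. integral\<^sup>L \<mu> (f k)) \<longlonglongrightarrow> integral\<^sup>L \<mu> (\<lambda>_. 0)"
  proof (rule integral_dominated_convergence)
    show "integrable \<mu> (bump i \<delta>)" by (rule MM_integrable_test[OF i \<mu> bump_test_function[OF i \<delta>]])
    show "f k \<in> borel_measurable \<mu>" for k
      using MM_integrable_test[OF i \<mu> f_test] by (rule borel_measurable_integrable)
    show "AE z in \<mu>. (\<lambda>k. f k z) \<longlonglongrightarrow> 0"
    proof (rule AE_I2, rule tendsto_eventually)
      fix z :: "real ^ 'd"
      obtain N :: nat where "norm z \<le> N" using real_arch_simple by blast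
      then show "\<forall>\<^sub>F k in sequentially. f k z = 0"
        by (intro eventually_sequentiallyI[of N]) (auto simp: f_def clamp01_def)
    qed
    show "AE z in \<mu>. norm (f k z) \<le> bump i \<delta> z" for k using f_bounds by simp
  qed simp
  then have "\<forall>\<^sub>F k in sequentially. integral\<^sup>L \<mu> (f k) < \<kappa>"
    using \<open>0 < \<kappa>\<close> by (intro order_tendstoD(2)) auto
  then obtain k where k: "integral\<^sup>L \<mu> (f k) < \<kappa>" by (auto simp: eventually_sequentially)
  have "\<forall>\<^sub>F t in at_top.
    t * measure P {\<omega> \<in> space P. i \<le> num_ge (\<delta> * b t) (X \<omega>) \<and> 1 \<le> f k (X \<omega> /\<^sub>R b t)} \<le> \<kappa>"
    by (rule MRV_eventually_prob_le[OF P i X f_test _ f_bounds(1) k \<delta>])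
       (intro borel_measurable_continuous_onI f_cont)
  with regularly_varying_pos[OF b] have "\<forall>\<^sub>F t in at_top.
    t * measure P {\<omega> \<in> space P. i \<le> num_ge (\<delta> * b t) (X \<omega>) \<and> real k + 1 \<le> norm (X \<omega> /\<^sub>R b t)} \<le> \<kappa>"
  proof eventually_elim
    case (elim t)
    have "1 \<le> f k (X \<omega> /\<^sub>R b t) \<longleftrightarrow> real k + 1 \<le> norm (X \<omega> /\<^sub>R b t)" if "i \<le> num_ge (\<delta> * b t) (X \<omega>)" for \<omega>
      using bump_eq_1[OF \<delta>, of i "X \<omega> /\<^sub>R b t"] that elim(1)
      by (auto simp: num_ge_scale f_def clamp01_def)
    then show ?case using elim(2) by (simp cong: conj_cong)
  qed
  then show thesis by (rule that)
qed

section \<open>Power bounds for tail probabilities\<close>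

lemma geometric_growth_le:
  fixes a :: "nat \<Rightarrow> real"
  assumes "0 < q" "\<And>k. k0 \<le> k \<Longrightarrow> 0 < a k" "\<And>k. k0 \<le> k \<Longrightarrow> a (Suc k) \<le> q * a k"
  obtains A where "A > 0" "\<And>k. k0 \<le> k \<Longrightarrow> a k \<le> A * q ^ k"
proof -
  have "a k \<le> a k0 / q ^ k0 * q ^ k" if "k0 \<le> k" for k
    using that
  proof (induction k rule: dec_induct)
    case base then show ?case using assms(1) by simp
  next
    case (step k)
    have "a (Suc k) \<le> q * a k" using assms(3) step by simp
    also have "\<dots> \<le> q * (a k0 / q ^ k0 * q ^ k)" using step assms(1) by (intro mult_left_mono) auto
    finally show ?case by (simp add: mult_ac)
  qed
  then show thesis using that[of "a k0 / q ^ k0"] assms(1) assms(2)[of k0] by simp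
qed

lemma geometric_growth_ge:
  fixes a :: "nat \<Rightarrow> real"
  assumes "0 < q" "\<And>k. k0 \<le> k \<Longrightarrow> 0 < a k" "\<And>k. k0 \<le> k \<Longrightarrow> q * a k \<le> a (Suc k)"
  obtains A where "A > 0" "\<And>k. k0 \<le> k \<Longrightarrow> A * q ^ k \<le> a k"
proof -
  have "a k0 / q ^ k0 * q ^ k \<le> a k" if "k0 \<le> k" for k
    using that
  proof (induction k rule: dec_induct)
    case base then show ?case using assms(1) by simp
  next
    case (step k)
    have "q * (a k0 / q ^ k0 * q ^ k) \<le> q * a k" using step assms(1) by (intro mult_left_mono) auto
    also have "\<dots> \<le> a (Suc k)" using assms(3) step by simp
    finally show ?case by (simp add: mult_ac)
  qed
  then show thesis using that[of "a k0 / q ^ k0"] assms(1) assms(2)[of k0] by simp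
qed

lemma filterlim_power2: "filterlim (\<lambda>k. 2 ^ k :: real) at_top sequentially"
  by (rule filterlim_at_infinity_imp_filterlim_at_top[OF filterlim_realpow_sequentially_gt1]) simp_all

lemma regularly_varying_ratio:
  assumes "regularly_varying \<beta> b"
  shows "(\<lambda>k. b (2 ^ Suc k) / b (2 ^ k)) \<longlonglongrightarrow> 2 powr \<beta>"
proof -
  have "((\<lambda>t. b (t * 2) / b t) \<longlongrightarrow> 2 powr \<beta>) at_top"
    using assms unfolding regularly_varying_def by (metis zero_less_numeral)
  from filterlim_compose[OF this filterlim_power2] show ?thesis by (simp add: mult.commute)
qed

lemma power_powr: "((2::real) powr q) ^ k = (2 ^ k) powr q"
  by (simp add: powr_realpow[symmetric] powr_powr mult.commute)

lemma dyadic_bracket: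
  fixes y :: real
  assumes "2 ^ k0 \<le> y"
  obtains k where "k0 \<le> k" "2 ^ k \<le> y" "y < 2 ^ Suc k"
proof -
  obtain n where n: "y < 2 ^ n" using real_arch_pow[of 2 y] by auto
  define m where "m = (LEAST n. y < 2 ^ n)"
  have m: "y < 2 ^ m" unfolding m_def using n by (rule LeastI)
  have "(2::real) ^ k0 < 2 ^ m" using assms m by linarith
  then have "k0 < m" by simp
  then obtain k where k: "m = Suc k" by (cases m) auto
  have "\<not> y < 2 ^ k" using not_less_Least[of k "\<lambda>n. y < 2 ^ n"] k m_def by simp
  then show thesis using that[of k] m k \<open>k0 < m\<close> by simp
qed

text \<open>Choose \<open>\<gamma> < \<alpha>\<close>.  Along the powers of two \<open>b\<close> eventually grows by factors below \<open>2 powr (1 / \<gamma>)\<close>, so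
\<open>b (2 ^ k) \<le> A * 2 powr (k / \<gamma>)\<close>, and the tail at this level is at most \<open>C / 2 ^ k\<close>.  An arbitrary \<open>x\<close>
lies between two consecutive such levels, and monotonicity of the tail interpolates.\<close>

lemma MRV_tail_le_powr:
  fixes X :: "'a \<Rightarrow> real ^ 'd"
  assumes P: "prob_space P" and i: "1 \<le> i" "i \<le> CARD('d)" and X: "MRV P X \<alpha> b \<mu> i"
    and \<gamma>: "0 < \<gamma>" "\<gamma> < \<alpha>"
  obtains C where "C > 0" "\<forall>\<^sub>F x in at_top. tail_prob P X i x \<le> C * x powr - \<gamma>"
proof -
  have b: "regularly_varying (1/\<alpha>) b" and Xm: "X \<in> borel_measurable P" using X by (auto simp: MRV_def)
  obtain C where C: "C > 0" "\<forall>\<^sub>F t in at_top. t * tail_prob P X i (1 * b t) \<le> C"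
    using MRV_tail_upper[OF P i X zero_less_one] .
  define q :: real where "q = 2 powr (1 / \<gamma>)"
  have q: "0 < q" "2 powr (1/\<alpha>) < q" using \<gamma> by (simp_all add: q_def frac_less2)
  have "\<forall>\<^sub>F k in sequentially. b (2 ^ Suc k) / b (2 ^ k) < q"
    using order_tendstoD(2)[OF regularly_varying_ratio[OF b] q(2)] .
  moreover have "\<forall>\<^sub>F k in sequentially. 0 < b (2 ^ k)"
    by (rule eventually_compose_filterlim[OF regularly_varying_pos[OF b] filterlim_power2])
  moreover have "\<forall>\<^sub>F k in sequentially. 2 ^ k * tail_prob P X i (1 * b (2 ^ k)) \<le> C"
    by (rule eventually_compose_filterlim[OF C(2) filterlim_power2])
  ultimately have "\<forall>\<^sub>F k in sequentially. b (2 ^ Suc k) \<le> q * b (2 ^ k) \<and> 0 < b (2 ^ k) \<and>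
      2 ^ k * tail_prob P X i (b (2 ^ k)) \<le> C"
    by eventually_elim (auto simp: divide_simps)
  then obtain k0 where k0: "\<And>k. k0 \<le> k \<Longrightarrow> b (2 ^ Suc k) \<le> q * b (2 ^ k)"
    "\<And>k. k0 \<le> k \<Longrightarrow> 0 < b (2 ^ k)" "\<And>k. k0 \<le> k \<Longrightarrow> 2 ^ k * tail_prob P X i (b (2 ^ k)) \<le> C"
    unfolding eventually_sequentially by blast
  obtain A where A: "A > 0" "\<And>k. k0 \<le> k \<Longrightarrow> b (2 ^ k) \<le> A * q ^ k"
    using geometric_growth_le[of q k0 "\<lambda>k. b (2 ^ k)"] q(1) k0 by metis
  have "tail_prob P X i x \<le> (2 * C * A powr \<gamma>) * x powr - \<gamma>" if x: "A * (2 ^ k0) powr (1 / \<gamma>) \<le> x" for x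
  proof -
    define y where "y = (x / A) powr \<gamma>"
    have x0: "0 < x" using x A(1) by (smt (verit) mult_pos_pos powr_gt_zero zero_less_power)
    have y_eq: "y = x powr \<gamma> / A powr \<gamma>" using x0 A(1) by (simp add: y_def powr_divide)
    have yx: "y powr (1 / \<gamma>) = x / A" using \<gamma> x0 A(1) by (simp add: y_def powr_powr)
    have "(2 ^ k0) powr (1 / \<gamma>) \<le> x / A" using x A(1) by (simp add: pos_le_divide_eq mult.commute)
    then have "((2 ^ k0) powr (1 / \<gamma>)) powr \<gamma> \<le> y" unfolding y_def using \<gamma> by (intro powr_mono2) auto
    then have "2 ^ k0 \<le> y" using \<gamma> by (simp add: powr_powr)
    then obtain k where k: "k0 \<le> k" "2 ^ k \<le> y" "y < 2 ^ Suc k" by (rule dyadic_bracket)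
    have y0: "0 < y" using k(2) by (smt (verit) zero_less_power)
    have "b (2 ^ k) \<le> A * q ^ k" by (rule A(2)[OF k(1)])
    also have "q ^ k = (2 ^ k) powr (1 / \<gamma>)" unfolding q_def by (simp only: power_powr)
    also have "\<dots> \<le> y powr (1 / \<gamma>)" using k(2) \<gamma> by (intro powr_mono2) auto
    finally have "b (2 ^ k) \<le> x" using A(1) by (simp add: yx)
    then have "tail_prob P X i x \<le> tail_prob P X i (b (2 ^ k))" by (rule tail_antimono[OF P Xm])
    also have "\<dots> \<le> C / 2 ^ k" using k0(3)[OF k(1)] by (simp add: pos_le_divide_eq mult.commute)
    also have "\<dots> \<le> 2 * C / y" using k(3) C(1) y0 by (simp add: divide_simps)
    also have "\<dots> = (2 * C * A powr \<gamma>) * x powr - \<gamma>"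
      unfolding y_eq powr_minus_divide by simp
    finally show ?thesis .
  qed
  then have "\<forall>\<^sub>F x in at_top. tail_prob P X i x \<le> (2 * C * A powr \<gamma>) * x powr - \<gamma>"
    unfolding eventually_at_top_linorder by blast
  then show thesis using that[of "2 * C * A powr \<gamma>"] C(1) A(1) by simp
qed

text \<open>The mirror image of \<open>MRV_tail_le_powr\<close>, with the level \<open>\<delta>\<close> of \<open>MRV_tail_lower\<close> absorbed into the
constant and \<open>x\<close> bounded by the dyadic level above it instead of the one below.\<close>

lemma MRV_tail_ge_powr:
  fixes X :: "'a \<Rightarrow> real ^ 'd"
  assumes P: "prob_space P" and i: "1 \<le> i" "i \<le> CARD('d)" and X: "MRV P X \<alpha> b \<mu> i"
    and \<gamma>: "\<alpha> < \<gamma>"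
  obtains c where "c > 0" "\<forall>\<^sub>F x in at_top. c * x powr - \<gamma> \<le> tail_prob P X i x"
proof -
  have b: "regularly_varying (1/\<alpha>) b" and Xm: "X \<in> borel_measurable P" and "0 < \<alpha>" using X by (auto simp: MRV_def)
  then have \<gamma>0: "0 < \<gamma>" using \<gamma> by simp
  obtain \<delta> c where \<delta>: "\<delta> > 0" and c: "c > 0" "\<forall>\<^sub>F t in at_top. c \<le> t * tail_prob P X i (\<delta> * b t)"
    using MRV_tail_lower[OF P i X] .
  define q :: real where "q = 2 powr (1 / \<gamma>)"
  have q: "0 < q" "q < 2 powr (1/\<alpha>)" using \<gamma> \<open>0 < \<alpha>\<close> by (simp_all add: q_def frac_less2)
  have "\<forall>\<^sub>F k in sequentially. q < b (2 ^ Suc k) / b (2 ^ k)"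
    using order_tendstoD(1)[OF regularly_varying_ratio[OF b] q(2)] .
  moreover have "\<forall>\<^sub>F k in sequentially. 0 < b (2 ^ k)"
    by (rule eventually_compose_filterlim[OF regularly_varying_pos[OF b] filterlim_power2])
  moreover have "\<forall>\<^sub>F k in sequentially. c \<le> 2 ^ k * tail_prob P X i (\<delta> * b (2 ^ k))"
    by (rule eventually_compose_filterlim[OF c(2) filterlim_power2])
  ultimately have "\<forall>\<^sub>F k in sequentially. q * b (2 ^ k) \<le> b (2 ^ Suc k) \<and> 0 < b (2 ^ k) \<and>
      c \<le> 2 ^ k * tail_prob P X i (\<delta> * b (2 ^ k))"
    by eventually_elim (auto simp: divide_simps)
  then obtain k0 where k0: "\<And>k. k0 \<le> k \<Longrightarrow> q * b (2 ^ k) \<le> b (2 ^ Suc k)"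
    "\<And>k. k0 \<le> k \<Longrightarrow> 0 < b (2 ^ k)" "\<And>k. k0 \<le> k \<Longrightarrow> c \<le> 2 ^ k * tail_prob P X i (\<delta> * b (2 ^ k))"
    unfolding eventually_sequentially by blast
  obtain A' where A': "A' > 0" "\<And>k. k0 \<le> k \<Longrightarrow> A' * q ^ k \<le> b (2 ^ k)"
    using geometric_growth_ge[of q k0 "\<lambda>k. b (2 ^ k)"] q(1) k0 by metis
  define A where "A = \<delta> * A'"
  have A: "A > 0" "\<And>k. k0 \<le> k \<Longrightarrow> A * q ^ k \<le> \<delta> * b (2 ^ k)"
    using A' \<delta> by (auto simp: A_def mult.assoc)
  have "(c / 2 * A powr \<gamma>) * x powr - \<gamma> \<le> tail_prob P X i x" if x: "A * (2 ^ k0) powr (1 / \<gamma>) \<le> x" for x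
  proof -
    define y where "y = (x / A) powr \<gamma>"
    have x0: "0 < x" using x A(1) by (smt (verit) mult_pos_pos powr_gt_zero zero_less_power)
    have y_eq: "y = x powr \<gamma> / A powr \<gamma>" using x0 A(1) by (simp add: y_def powr_divide)
    have yx: "y powr (1 / \<gamma>) = x / A" using \<gamma>0 x0 A(1) by (simp add: y_def powr_powr)
    have "(2 ^ k0) powr (1 / \<gamma>) \<le> x / A" using x A(1) by (simp add: pos_le_divide_eq mult.commute)
    then have "((2 ^ k0) powr (1 / \<gamma>)) powr \<gamma> \<le> y" unfolding y_def using \<gamma>0 by (intro powr_mono2) auto
    then have "2 ^ k0 \<le> y" using \<gamma>0 by (simp add: powr_powr)
    then obtain k where k: "k0 \<le> k" "2 ^ k \<le> y" "y < 2 ^ Suc k" by (rule dyadic_bracket)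
    have k1: "k0 \<le> Suc k" using k(1) by simp
    have y0: "0 < y" using k(2) by (smt (verit) zero_less_power)
    have "x = A * y powr (1 / \<gamma>)" using A(1) by (simp add: yx)
    also have "\<dots> \<le> A * (2 ^ Suc k) powr (1 / \<gamma>)" using k(3) y0 \<gamma>0 A(1) by (intro mult_left_mono powr_mono2) auto
    also have "(2 ^ Suc k) powr (1 / \<gamma>) = q ^ Suc k" unfolding q_def by (simp only: power_powr)
    also have "A * q ^ Suc k \<le> \<delta> * b (2 ^ Suc k)" by (rule A(2)[OF k1])
    finally have "tail_prob P X i (\<delta> * b (2 ^ Suc k)) \<le> tail_prob P X i x" by (rule tail_antimono[OF P Xm])
    moreover have "c / 2 ^ Suc k \<le> tail_prob P X i (\<delta> * b (2 ^ Suc k))"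
      using k0(3)[OF k1] by (simp add: pos_divide_le_eq mult.commute)
    moreover have "c / (2 * y) \<le> c / 2 ^ Suc k" using k(2) c(1) y0 by (intro divide_left_mono) auto
    moreover have "c / (2 * y) = (c / 2 * A powr \<gamma>) * x powr - \<gamma>"
      unfolding y_eq powr_minus_divide by simp
    ultimately show ?thesis by linarith
  qed
  then have "\<forall>\<^sub>F x in at_top. (c / 2 * A powr \<gamma>) * x powr - \<gamma> \<le> tail_prob P X i x"
    unfolding eventually_at_top_linorder by blast
  moreover have "c / 2 * A powr \<gamma> > 0" using c(1) A(1) by simp
  ultimately show thesis using that by blast
qed

text \<open>The tail at level \<open>b t\<close> tends to zero, while by \<open>MRV_tail_ge_powr\<close> the tail at any fixed level is
positive; so \<open>b t\<close> eventually exceeds every level.\<close>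

lemma MRV_scaling_at_top:
  fixes X :: "'a \<Rightarrow> real ^ 'd"
  assumes P: "prob_space P" and i: "1 \<le> i" "i \<le> CARD('d)" and X: "MRV P X \<alpha> b \<mu> i"
  shows "filterlim b at_top at_top"
  unfolding filterlim_at_top
proof
  fix x :: real
  have Xm: "X \<in> borel_measurable P" using X by (auto simp: MRV_def)
  obtain C where C: "C > 0" "\<forall>\<^sub>F t in at_top. t * tail_prob P X i (1 * b t) \<le> C"
    using MRV_tail_upper[OF P i X zero_less_one] .
  obtain c where c: "c > 0" "\<forall>\<^sub>F x in at_top. c * x powr - (\<alpha> + 1) \<le> tail_prob P X i x"
    using MRV_tail_ge_powr[OF P i X, of "\<alpha> + 1"] by auto
  have "\<forall>\<^sub>F y in at_top. x \<le> y \<and> 0 < y \<and> c * y powr - (\<alpha> + 1) \<le> tail_prob P X i y"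
    using c(2) eventually_ge_at_top[of x] eventually_gt_at_top[of 0] by eventually_elim simp
  then obtain y where y: "x \<le> y" "0 < y" "c * y powr - (\<alpha> + 1) \<le> tail_prob P X i y"
    unfolding eventually_at_top_linorder by blast
  have "0 < c * y powr - (\<alpha> + 1)" using y c(1) by simp
  then have pos: "0 < tail_prob P X i x" using y tail_antimono[OF P Xm y(1), of i] by linarith
  from C(2) eventually_gt_at_top[of 0] eventually_gt_at_top[of "C / tail_prob P X i x"]
  show "\<forall>\<^sub>F t in at_top. x \<le> b t"
  proof eventually_elim
    case (elim t)
    show ?case
    proof (rule ccontr)
      assume "\<not> x \<le> b t"
      then have "tail_prob P X i x \<le> tail_prob P X i (b t)" by (intro tail_antimono[OF P Xm]) simp
      then have "t * tail_prob P X i x \<le> C" using elim by (smt (verit) mult_1 mult_left_mono)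
      with elim(3) pos show False by (simp add: pos_divide_less_eq)
    qed
  qed
qed

text \<open>At level \<open>x = \<delta> * b t\<close> the factor \<open>t\<close> is bounded by a constant over the tail of order \<open>i\<close>, hence by a
multiple of \<open>x powr (\<alpha> + \<theta>)\<close>, and the two tails by multiples of \<open>x powr - (\<alpha>m - \<theta>)\<close> and
\<open>x powr - (\<alpha>l - \<theta>)\<close>.  For small \<open>\<theta>\<close> the total exponent is negative.  Each of the three tails has its
own scaling function; the power bounds make them comparable.\<close>

lemma cross_tail_tendsto_0:
  fixes X Y :: "'a \<Rightarrow> real ^ 'd"
  assumes P: "prob_space P" and i: "1 \<le> i" "i \<le> CARD('d)" and X: "MRV P X \<alpha> b \<mu> i"
    and m: "1 \<le> m" "m \<le> CARD('d)" and Xm: "MRV P X \<alpha>m bm \<mu>m m"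
    and l: "1 \<le> l" "l \<le> CARD('d)" and Yl: "MRV P Y \<alpha>l bl \<mu>l l"
    and less: "\<alpha> < \<alpha>m + \<alpha>l" and \<delta>: "0 < \<delta>"
  shows "((\<lambda>t. t * (tail_prob P X m (\<delta> * b t) * tail_prob P Y l (\<delta> * b t))) \<longlongrightarrow> 0) at_top"
proof -
  have \<alpha>: "0 < \<alpha>" "0 < \<alpha>m" "0 < \<alpha>l" using X Xm Yl by (simp_all add: MRV_def)
  \<comment> \<open>Three exponents each lose \<open>\<theta>\<close>, and the positive slack \<open>\<alpha>m + \<alpha>l - \<alpha>\<close> has to survive.\<close>
  define \<theta> where "\<theta> = Min {\<alpha>m / 2, \<alpha>l / 2, (\<alpha>m + \<alpha>l - \<alpha>) / 6}"
  have \<theta>: "0 < \<theta>" "\<theta> < \<alpha>m" "\<theta> < \<alpha>l" "3 * \<theta> < \<alpha>m + \<alpha>l - \<alpha>" using \<alpha> less by (auto simp: \<theta>_def min_def)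
  obtain C where C: "C > 0" "\<forall>\<^sub>F t in at_top. t * tail_prob P X i (\<delta> * b t) \<le> C"
    using MRV_tail_upper[OF P i X \<delta>] .
  obtain c where c: "c > 0" "\<forall>\<^sub>F x in at_top. c * x powr - (\<alpha> + \<theta>) \<le> tail_prob P X i x"
    using MRV_tail_ge_powr[OF P i X, of "\<alpha> + \<theta>"] \<theta> by auto
  obtain D where D: "D > 0" "\<forall>\<^sub>F x in at_top. tail_prob P X m x \<le> D * x powr - (\<alpha>m - \<theta>)"
    using MRV_tail_le_powr[OF P m Xm, of "\<alpha>m - \<theta>"] \<theta> by auto
  obtain E where E: "E > 0" "\<forall>\<^sub>F x in at_top. tail_prob P Y l x \<le> E * x powr - (\<alpha>l - \<theta>)"
    using MRV_tail_le_powr[OF P l Yl, of "\<alpha>l - \<theta>"] \<theta> by auto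
  define \<rho> where "\<rho> = \<alpha>m + \<alpha>l - \<alpha> - 3 * \<theta>"
  have "0 < \<rho>" using \<theta> by (simp add: \<rho>_def)
  have b: "filterlim (\<lambda>t. \<delta> * b t) at_top at_top"
    using MRV_scaling_at_top[OF P i X] \<delta> by (rule filterlim_tendsto_pos_mult_at_top[OF tendsto_const, rotated])
  have "\<forall>\<^sub>F t in at_top. norm (t * (tail_prob P X m (\<delta> * b t) * tail_prob P Y l (\<delta> * b t))) \<le> (C / c * D * E) * (\<delta> * b t) powr - \<rho>"
    using C(2) eventually_gt_at_top[of 0] eventually_compose_filterlim[OF c(2) b]
      eventually_compose_filterlim[OF D(2) b] eventually_compose_filterlim[OF E(2) b]
      eventually_compose_filterlim[OF eventually_gt_at_top[of 0] b]
  proof eventually_elim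
    case (elim t)
    define x where "x = \<delta> * b t"
    note el = elim[folded x_def]
    have "t * (c * x powr - (\<alpha> + \<theta>)) \<le> t * tail_prob P X i x" using el by (intro mult_left_mono) auto
    then have "t * (c * x powr - (\<alpha> + \<theta>)) \<le> C" using el by linarith
    then have t: "t \<le> C / c * x powr (\<alpha> + \<theta>)"
      using el c(1) by (simp add: powr_minus divide_simps mult_ac del: minus_add_distrib)
    have "t * (tail_prob P X m x * tail_prob P Y l x)
        \<le> (C / c * x powr (\<alpha> + \<theta>)) * ((D * x powr - (\<alpha>m - \<theta>)) * (E * x powr - (\<alpha>l - \<theta>)))"
      using t el C(1) c(1) D(1) E(1) by (intro mult_mono) (auto simp: tail_nonneg)
    also have "\<dots> = (C / c * D * E) * (x powr (\<alpha> + \<theta>) * x powr - (\<alpha>m - \<theta>) * x powr - (\<alpha>l - \<theta>))" by simp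
    also have "x powr (\<alpha> + \<theta>) * x powr - (\<alpha>m - \<theta>) * x powr - (\<alpha>l - \<theta>) = x powr - \<rho>"
      by (simp add: powr_add[symmetric] \<rho>_def algebra_simps)
    finally show ?case using el(2) by (simp add: x_def[symmetric] tail_nonneg)
  qed
  moreover have "((\<lambda>t. (C / c * D * E) * (\<delta> * b t) powr - \<rho>) \<longlongrightarrow> 0) at_top"
    using tendsto_neg_powr[OF _ b, of "- \<rho>"] \<open>0 < \<rho>\<close> by (intro tendsto_mult_right_zero) auto
  ultimately show ?thesis by (rule Lim_null_comparison)
qed

section \<open>The sum of two independent vectors\<close>

lemma num_ge_add_le:
  assumes "x \<le> \<epsilon> / 2"
  shows "num_ge \<epsilon> (z + w) \<le> num_ge x z + num_ge x w"
proof -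
  have "num_ge \<epsilon> (z + w) \<le> card ({j. x \<le> z $ j} \<union> {j. x \<le> w $ j})"
    unfolding num_ge_def using assms by (intro card_mono) auto
  also have "\<dots> \<le> num_ge x z + num_ge x w" unfolding num_ge_def by (rule card_Un_le)
  finally show ?thesis .
qed

lemma num_ge_eq_0_iff: "num_ge x z = 0 \<longleftrightarrow> (\<forall>j. z $ j < x)"
  by (auto simp: num_ge_def not_le)

text \<open>The maximum with \<open>1\<close> keeps the case in which one summand alone has \<open>i\<close> large entries while the other
has at least one; it is as negligible as the genuine splittings, and for \<open>i = 1\<close> it is the only one.\<close>

lemma split_counts:
  fixes p q i :: nat
  assumes "1 \<le> p" "1 \<le> q" "i \<le> p + q" "1 \<le> i"
  shows "\<exists>m\<in>{1..i}. m \<le> p \<and> max 1 (i - m) \<le> q"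
  using assms by (intro bexI[of _ "min p i"]) auto

text \<open>The deterministic core of the single big jump principle.  If the defect of additivity is non-zero,
then the counts of entries above \<open>\<eta>\<close> sum to at least \<open>i\<close>.  When both counts are positive, the last
sum contributes.  When all entries of \<open>w\<close> are below \<open>\<eta>\<close>, then \<open>g w = 0\<close> and the defect is the change
of \<open>g\<close> under a small shift, which is small on a bounded set and at most \<open>2 * B\<close> elsewhere.  The
indicators in front use the fixed level \<open>\<epsilon> / 2\<close> rather than \<open>\<eta>\<close>: their probabilities must not depend
on \<open>\<eta>\<close>, which is chosen after \<open>\<kappa>\<close>.\<close>

lemma additivity_defect_bound:
  fixes g :: "real ^ 'd \<Rightarrow> real"
  assumes i: "1 \<le> i" and z: "z \<in> nonneg_orthant" and w: "w \<in> nonneg_orthant"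
    and B: "\<And>z. \<bar>g z\<bar> \<le> B" and supp: "\<And>z. g z \<noteq> 0 \<Longrightarrow> i \<le> num_ge \<epsilon> z"
    and \<eta>: "0 < \<eta>" "\<eta> \<le> \<epsilon> / 2" and "0 \<le> \<kappa>"
    and cont: "\<And>z w. z \<in> nonneg_orthant \<Longrightarrow> w \<in> nonneg_orthant \<Longrightarrow> norm z \<le> max R R' \<Longrightarrow>
      \<forall>j. w $ j < \<eta> \<Longrightarrow> \<bar>g (z + w) - g z\<bar> \<le> \<kappa>"
  shows "\<bar>g (z + w) - g z - g w\<bar> \<le>
    \<kappa> * of_bool (i \<le> num_ge (\<epsilon> / 2) z) + 2 * B * of_bool (i \<le> num_ge (\<epsilon> / 2) z \<and> R \<le> norm z) +
    \<kappa> * of_bool (i \<le> num_ge (\<epsilon> / 2) w) + 2 * B * of_bool (i \<le> num_ge (\<epsilon> / 2) w \<and> R' \<le> norm w) +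
    3 * B * (\<Sum>m\<in>{1..i}. of_bool (m \<le> num_ge \<eta> z \<and> max 1 (i - m) \<le> num_ge \<eta> w))"
    (is "_ \<le> ?a z + ?b R z + ?a w + ?b R' w + 3 * B * ?S z w")
proof -
  have B0: "0 \<le> B" using B[of 0] by linarith
  have S0: "0 \<le> ?S z w" for z w by (intro sum_nonneg) auto
  have ab0: "0 \<le> ?a z" "0 \<le> ?b r z" for r and z :: "real ^ 'd" using B0 \<open>0 \<le> \<kappa>\<close> by auto
  \<comment> \<open>Stated for arbitrary \<open>z\<close> and \<open>w\<close>, so that it can be used with their roles exchanged.\<close>
  have small: "\<bar>g (z + w) - g z - g w\<bar> \<le> ?a z + ?b r z"
    if z: "z \<in> nonneg_orthant" and w: "w \<in> nonneg_orthant" and "num_ge \<eta> w = 0" "r \<le> max R R'" for z w r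
  proof -
    have lt: "w $ j < \<eta>" for j using that(3) by (simp add: num_ge_eq_0_iff)
    have "num_ge (\<epsilon> / 2) w = 0" "num_ge \<epsilon> w = 0"
      unfolding num_ge_eq_0_iff using lt \<eta> by (smt (verit) field_sum_of_halves)+
    then have gw: "g w = 0" and le: "num_ge \<epsilon> (z + w) \<le> num_ge (\<epsilon> / 2) z"
      using supp[of w] i num_ge_add_le[of "\<epsilon> / 2" \<epsilon> z w] by auto
    show ?thesis
    proof (cases "i \<le> num_ge (\<epsilon> / 2) z")
      case True
      show ?thesis
      proof (cases "norm z \<le> r")
        case le: True
        have "\<bar>g (z + w) - g z\<bar> \<le> \<kappa>" using le \<open>r \<le> max R R'\<close> lt by (intro cont[OF z w]) auto
        then show ?thesis using True gw B0 by auto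
      next
        case False
        have "\<bar>g (z + w) - g z\<bar> \<le> 2 * B" using B[of z] B[of "z + w"] by linarith
        then show ?thesis using True False gw \<open>0 \<le> \<kappa>\<close> by auto
      qed
    next
      case False
      have "num_ge \<epsilon> z \<le> num_ge (\<epsilon> / 2) z" using \<eta> by (intro num_ge_antimono) simp
      then have "g z = 0" "g (z + w) = 0" using False le supp[of z] supp[of "z + w"] by auto
      then show ?thesis using gw ab0(1)[of z] ab0(2)[of z r] by simp
    qed
  qed
  let ?p = "num_ge \<eta> z" and ?q = "num_ge \<eta> w"
  consider "?q = 0" | "?p = 0" | "?p + ?q < i" | "1 \<le> ?p" "1 \<le> ?q" "i \<le> ?p + ?q" by linarith
  then show ?thesis
  proof cases
    case 1
    have "0 \<le> 3 * B * ?S z w" using B0 S0 by simp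
    then show ?thesis using small[OF z w 1, of R] ab0(1)[of w] ab0(2)[of w R'] by linarith
  next
    case 2
    have "0 \<le> 3 * B * ?S z w" using B0 S0 by simp
    moreover have "\<bar>g (z + w) - g z - g w\<bar> \<le> ?a w + ?b R' w" using small[OF w z 2, of R'] by (simp add: add.commute)
    ultimately show ?thesis using ab0(1)[of z] ab0(2)[of z R] by linarith
  next
    case 3
    have "num_ge \<epsilon> z \<le> ?p" "num_ge \<epsilon> w \<le> ?q" using \<eta> by (auto intro!: num_ge_antimono)
    moreover have "num_ge \<epsilon> (z + w) \<le> ?p + ?q" using \<eta> by (intro num_ge_add_le)
    ultimately have "g z = 0" "g w = 0" "g (z + w) = 0"
      using 3 supp[of z] supp[of w] supp[of "z + w"] by linarith+
    moreover have "0 \<le> 3 * B * ?S z w" using B0 S0 by simp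
    ultimately show ?thesis using ab0(1)[of z] ab0(2)[of z R] ab0(1)[of w] ab0(2)[of w R'] by linarith
  next
    case 4
    obtain m where m: "m \<in> {1..i}" "m \<le> ?p \<and> max 1 (i - m) \<le> ?q" using split_counts[OF 4 i] by blast
    have "1 = of_bool (m \<le> num_ge \<eta> z \<and> max 1 (i - m) \<le> num_ge \<eta> w)" using m by simp
    also have "\<dots> \<le> ?S z w" using m(1) by (intro member_le_sum) auto
    finally have "3 * B * 1 \<le> 3 * B * ?S z w" using B0 by (intro mult_left_mono) auto
    moreover have "\<bar>g (z + w) - g z - g w\<bar> \<le> 3 * B"
      using B[of z] B[of w] B[of "z + w"] by linarith
    ultimately show ?thesis using ab0(1)[of z] ab0(2)[of z R] ab0(1)[of w] ab0(2)[of w R'] by linarith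
  qed
qed

text \<open>Uniform continuity on a compact part of the orthant; the radius is enlarged by one to contain the
shifted point.\<close>

lemma shift_modulus:
  fixes g :: "real ^ 'd \<Rightarrow> real"
  assumes g: "continuous_on nonneg_orthant g" and "0 < \<kappa>"
  obtains \<eta> where "0 < \<eta>" "\<And>z w. z \<in> nonneg_orthant \<Longrightarrow> w \<in> nonneg_orthant \<Longrightarrow> norm z \<le> R \<Longrightarrow>
      \<forall>j. w $ j < \<eta> \<Longrightarrow> \<bar>g (z + w) - g z\<bar> \<le> \<kappa>"
proof -
  let ?K = "nonneg_orthant \<inter> cball 0 (R + 1) :: (real ^ 'd) set"
  have "compact ?K" by (intro closed_Int_compact closed_nonneg_orthant compact_cball)
  then have "uniformly_continuous_on ?K g"
    using g continuous_on_subset by (intro compact_uniformly_continuous) blast+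
  then obtain \<delta> where \<delta>: "0 < \<delta>" "\<And>x y. x \<in> ?K \<Longrightarrow> y \<in> ?K \<Longrightarrow> dist y x < \<delta> \<Longrightarrow> dist (g y) (g x) < \<kappa>"
    using \<open>0 < \<kappa>\<close> unfolding uniformly_continuous_on_def by metis
  define \<eta> where "\<eta> = min \<delta> 1 / (2 * real CARD('d))"
  have \<eta>: "0 < \<eta>" using \<delta>(1) by (simp add: \<eta>_def)
  have "\<bar>g (z + w) - g z\<bar> \<le> \<kappa>"
    if z: "z \<in> nonneg_orthant" and w: "w \<in> nonneg_orthant" and R: "norm z \<le> R" and lt: "\<forall>j. w $ j < \<eta>" for z w
  proof -
    have "norm w \<le> (\<Sum>j\<in>UNIV. \<bar>w $ j\<bar>)" by (rule norm_le_l1_cart)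
    also have "\<dots> \<le> (\<Sum>j\<in>(UNIV::'d set). \<eta>)"
      using w lt by (intro sum_mono) (simp add: nonneg_orthant_def less_imp_le)
    also have "\<dots> = min \<delta> 1 / 2" by (simp add: \<eta>_def)
    finally have n: "norm w < \<delta>" "norm w < 1" using \<delta>(1) by auto
    have "norm (z + w) \<le> R + 1" using norm_triangle_ineq[of z w] n R by linarith
    moreover have "z + w \<in> nonneg_orthant" using z w by (simp add: nonneg_orthant_def)
    ultimately have "z + w \<in> ?K" "z \<in> ?K" using z R by simp_all
    then have "dist (g (z + w)) (g z) < \<kappa>"
      by (intro \<delta>(2)) (use n in \<open>simp_all add: dist_norm\<close>)
    then show ?thesis by (simp add: dist_real_def)
  qed
  then show thesis using that \<eta> by blast
qed

lemma indep_joint_tail: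
  fixes X Y :: "'a \<Rightarrow> real ^ 'd"
  assumes "prob_space P" "prob_space.indep_var P borel X borel Y"
  shows "measure P {\<omega> \<in> space P. m \<le> num_ge x (X \<omega>) \<and> l \<le> num_ge x (Y \<omega>)} = tail_prob P X m x * tail_prob P Y l x"
proof -
  interpret prob_space P by fact
  have "measure P ((\<lambda>\<omega>. (X \<omega>, Y \<omega>)) -` ({z. m \<le> num_ge x z} \<times> {z. l \<le> num_ge x z}) \<inter> space P)
      = measure P (X -` {z. m \<le> num_ge x z} \<inter> space P) * measure P (Y -` {z. l \<le> num_ge x z} \<inter> space P)"
    using assms(2) by (rule indep_varD) (intro borel_closed closed_num_ge)+
  then show ?thesis
    by (simp add: tail_prob_def vimage_def Int_def conj_ac)
qed

lemma expected_defect_bound: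
  fixes X Y :: "'a \<Rightarrow> real ^ 'd" and f :: "real ^ 'd \<Rightarrow> real"
  assumes P: "prob_space P" and i: "1 \<le> i" "i \<le> CARD('d)"
    and X: "X \<in> borel_measurable P" "\<And>\<omega>. \<omega> \<in> space P \<Longrightarrow> X \<omega> \<in> nonneg_orthant"
    and Y: "Y \<in> borel_measurable P" "\<And>\<omega>. \<omega> \<in> space P \<Longrightarrow> Y \<omega> \<in> nonneg_orthant"
    and indep: "prob_space.indep_var P borel X borel Y"
    and f: "MM_test_function i f" and s: "0 < s"
    and B: "\<And>z. \<bar>zero_ext i f z\<bar> \<le> B" and supp: "\<And>z. zero_ext i f z \<noteq> 0 \<Longrightarrow> i \<le> num_ge \<epsilon> z"
    and \<eta>: "0 < \<eta>" "\<eta> \<le> \<epsilon> / 2" and "0 \<le> \<kappa>"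
    and cont: "\<And>z w. z \<in> nonneg_orthant \<Longrightarrow> w \<in> nonneg_orthant \<Longrightarrow> norm z \<le> max R R' \<Longrightarrow>
      \<forall>j. w $ j < \<eta> \<Longrightarrow> \<bar>zero_ext i f (z + w) - zero_ext i f z\<bar> \<le> \<kappa>"
  shows "\<bar>(\<integral>\<omega>. zero_ext i f ((X \<omega> + Y \<omega>) /\<^sub>R s) \<partial>P) - (\<integral>\<omega>. zero_ext i f (X \<omega> /\<^sub>R s) \<partial>P)
      - (\<integral>\<omega>. zero_ext i f (Y \<omega> /\<^sub>R s) \<partial>P)\<bar> \<le>
    \<kappa> * tail_prob P X i (\<epsilon> / 2 * s)
      + 2 * B * measure P {\<omega> \<in> space P. i \<le> num_ge (\<epsilon> / 2 * s) (X \<omega>) \<and> R \<le> norm (X \<omega> /\<^sub>R s)}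
    + \<kappa> * tail_prob P Y i (\<epsilon> / 2 * s)
      + 2 * B * measure P {\<omega> \<in> space P. i \<le> num_ge (\<epsilon> / 2 * s) (Y \<omega>) \<and> R' \<le> norm (Y \<omega> /\<^sub>R s)}
    + 3 * B * (\<Sum>m\<in>{1..i}. tail_prob P X m (\<eta> * s) * tail_prob P Y (max 1 (i - m)) (\<eta> * s))"
proof -
  interpret prob_space P by fact
  note [measurable] = X(1) Y(1)
  let ?g = "zero_ext i f"
  define D where "D \<omega> = ?g ((X \<omega> + Y \<omega>) /\<^sub>R s) - ?g (X \<omega> /\<^sub>R s) - ?g (Y \<omega> /\<^sub>R s)" for \<omega>
  define T where "T W = {\<omega> \<in> space P. i \<le> num_ge (\<epsilon> / 2 * s) (W \<omega>)}" for W :: "'a \<Rightarrow> real ^ 'd"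
  define V where "V r W = {\<omega> \<in> space P. i \<le> num_ge (\<epsilon> / 2 * s) (W \<omega>) \<and> r \<le> norm (W \<omega> /\<^sub>R s)}"
    for r and W :: "'a \<Rightarrow> real ^ 'd"
  define J where "J m = {\<omega> \<in> space P. m \<le> num_ge (\<eta> * s) (X \<omega>) \<and> max 1 (i - m) \<le> num_ge (\<eta> * s) (Y \<omega>)}" for m
  have T: "T W \<in> sets P" and V: "V r W \<in> sets P" if [measurable]: "W \<in> borel_measurable P" for W r
  proof -
    show 1: "T W \<in> sets P" unfolding T_def by (rule sets_tail[OF that])
    have "V r W = T W \<inter> {\<omega> \<in> space P. r \<le> norm (W \<omega> /\<^sub>R s)}" by (auto simp: V_def T_def)
    also have "\<dots> \<in> sets P" by (rule sets.Int[OF 1]) measurable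
    finally show "V r W \<in> sets P" .
  qed
  have J: "J m \<in> sets P" for m
  proof -
    have "J m = {\<omega> \<in> space P. m \<le> num_ge (\<eta> * s) (X \<omega>)} \<inter> {\<omega> \<in> space P. max 1 (i - m) \<le> num_ge (\<eta> * s) (Y \<omega>)}"
      by (auto simp: J_def)
    then show ?thesis using sets_tail[OF X(1)] sets_tail[OF Y(1)] by auto
  qed
  note int_g = integrable_zero_ext[OF P i f, of _ s]
  have intD: "integrable P D"
    unfolding D_def using X(1) Y(1) by (intro Bochner_Integration.integrable_diff int_g) auto
  let ?bnd = "\<lambda>\<omega>. \<kappa> * indicator (T X) \<omega> + 2 * B * indicator (V R X) \<omega>
      + \<kappa> * indicator (T Y) \<omega> + 2 * B * indicator (V R' Y) \<omega>
      + 3 * B * (\<Sum>m\<in>{1..i}. indicator (J m) \<omega>)"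
  have int_ind: "integrable P (indicat_real A)" if "A \<in> sets P" for A
    using that by (simp add: integrable_indicator_iff less_top[symmetric])
  note ints = int_ind[OF T[OF X(1)]] int_ind[OF V[OF X(1)]] int_ind[OF T[OF Y(1)]] int_ind[OF V[OF Y(1)]] int_ind[OF J]
  have "\<bar>integral\<^sup>L P D\<bar> \<le> (\<integral>\<omega>. \<bar>D \<omega>\<bar> \<partial>P)" by (rule integral_abs_bound)
  also have "\<dots> \<le> integral\<^sup>L P ?bnd"
  proof (rule integral_mono)
    show "integrable P (\<lambda>\<omega>. \<bar>D \<omega>\<bar>)" using intD by (rule integrable_abs)
    show "integrable P ?bnd" using ints by (intro Bochner_Integration.integrable_add integrable_mult_right Bochner_Integration.integrable_sum)
    fix \<omega> assume w: "\<omega> \<in> space P"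
    let ?x = "X \<omega> /\<^sub>R s" and ?y = "Y \<omega> /\<^sub>R s"
    have xy: "?x \<in> nonneg_orthant" "?y \<in> nonneg_orthant"
      using X(2)[OF w] Y(2)[OF w] s by (auto simp: nonneg_orthant_def)
    have ind: "indicator (T W) \<omega> = of_bool (i \<le> num_ge (\<epsilon> / 2) (W \<omega> /\<^sub>R s))"
      "indicator (V r W) \<omega> = of_bool (i \<le> num_ge (\<epsilon> / 2) (W \<omega> /\<^sub>R s) \<and> r \<le> norm (W \<omega> /\<^sub>R s))"
      "indicator (J m) \<omega> = of_bool (m \<le> num_ge \<eta> ?x \<and> max 1 (i - m) \<le> num_ge \<eta> ?y)" for W r m
      unfolding T_def V_def J_def num_ge_scale[OF s] using w by (auto simp: indicator_def)
    have "D \<omega> = ?g (?x + ?y) - ?g ?x - ?g ?y" by (simp add: D_def scaleR_add_right)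
    then show "\<bar>D \<omega>\<bar> \<le> ?bnd \<omega>"
      unfolding ind by (simp only:) (rule additivity_defect_bound[OF i(1) xy B supp \<eta> \<open>0 \<le> \<kappa>\<close> cont])
  qed
  also have "\<dots> = \<kappa> * measure P (T X) + 2 * B * measure P (V R X) + \<kappa> * measure P (T Y) + 2 * B * measure P (V R' Y)
      + 3 * B * (\<Sum>m\<in>{1..i}. measure P (J m))"
    using ints T[OF X(1)] V[OF X(1)] T[OF Y(1)] V[OF Y(1)] J by simp
  also have "integral\<^sup>L P D = (\<integral>\<omega>. ?g ((X \<omega> + Y \<omega>) /\<^sub>R s) \<partial>P) - (\<integral>\<omega>. ?g (X \<omega> /\<^sub>R s) \<partial>P) - (\<integral>\<omega>. ?g (Y \<omega> /\<^sub>R s) \<partial>P)"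
    unfolding D_def using int_g[of "\<lambda>\<omega>. X \<omega> + Y \<omega>"] int_g[OF X(1)] int_g[OF Y(1)] by simp
  finally show ?thesis
    unfolding T_def V_def J_def indep_joint_tail[OF P indep] tail_prob_def[symmetric] .
qed

lemma tendsto_0_if_arbitrarily_small:
  fixes h :: "'a \<Rightarrow> real"
  assumes "\<And>\<kappa>. 0 < \<kappa> \<Longrightarrow> \<forall>\<^sub>F t in F. \<bar>h t\<bar> \<le> K * \<kappa>"
  shows "(h \<longlongrightarrow> 0) F"
proof (rule tendstoI)
  fix e :: real assume "0 < e"
  define \<kappa> where "\<kappa> = e / (2 * (\<bar>K\<bar> + 1))"
  have "0 < \<kappa>" using \<open>0 < e\<close> by (simp add: \<kappa>_def)
  have "K * \<kappa> \<le> (\<bar>K\<bar> + 1) * \<kappa>" using \<open>0 < \<kappa>\<close> by (intro mult_right_mono) auto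
  also have "\<dots> = e / 2" unfolding \<kappa>_def by (simp add: divide_simps)
  finally have "K * \<kappa> < e" using \<open>0 < e\<close> by simp
  with assms[OF \<open>0 < \<kappa>\<close>] show "\<forall>\<^sub>F t in F. dist (h t) 0 < e"
    by (auto elim: eventually_mono)
qed

text \<open>The order of the choices matters: \<open>\<epsilon>\<close> comes from the support of \<open>f\<close>, then \<open>\<kappa>\<close> is given, then tightness
provides the radii, then uniform continuity on the corresponding ball provides \<open>\<eta>\<close>, and only then
\<open>t\<close> tends to infinity, which removes the cross terms at level \<open>\<eta>\<close>.\<close>

lemma defect_tendsto_0:
  fixes X Y :: "'a \<Rightarrow> real ^ 'd"
  assumes P: "prob_space P"
    and X: "\<And>i. i \<in> {1..CARD('d)} \<Longrightarrow> MRV P X (\<alpha> i) (b i) (\<mu> i) i"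
    and Y: "\<And>i. i \<in> {1..CARD('d)} \<Longrightarrow> MRV P Y (\<alpha> i) (b i) (\<nu> i) i"
    and indep: "prob_space.indep_var P borel X borel Y"
    and less: "\<And>i m. i \<in> {2..CARD('d)} \<Longrightarrow> m \<in> {1..i - 1} \<Longrightarrow> \<alpha> i < \<alpha> m + \<alpha> (i - m)"
    and i: "1 \<le> i" "i \<le> CARD('d)" and f: "MM_test_function i f"
  shows "((\<lambda>t. t * ((\<integral>\<omega>. zero_ext i f ((X \<omega> + Y \<omega>) /\<^sub>R b i t) \<partial>P)
      - (\<integral>\<omega>. zero_ext i f (X \<omega> /\<^sub>R b i t) \<partial>P) - (\<integral>\<omega>. zero_ext i f (Y \<omega> /\<^sub>R b i t) \<partial>P))) \<longlongrightarrow> 0) at_top"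
proof -
  have i': "i \<in> {1..CARD('d)}" using i by simp
  note Xi = X[OF i'] and Yi = Y[OF i']
  have Xm: "X \<in> borel_measurable P" "\<And>\<omega>. \<omega> \<in> space P \<Longrightarrow> X \<omega> \<in> nonneg_orthant"
    and Ym: "Y \<in> borel_measurable P" "\<And>\<omega>. \<omega> \<in> space P \<Longrightarrow> Y \<omega> \<in> nonneg_orthant"
    and b: "regularly_varying (1 / \<alpha> i) (b i)"
    using Xi Yi by (auto simp: MRV_def)
  obtain B \<epsilon> where \<epsilon>: "\<epsilon> > 0" and "B > 0" and B': "\<And>z. z \<in> EE i \<Longrightarrow> \<bar>f z\<bar> \<le> B"
    and supp': "\<And>z. z \<in> EE i \<Longrightarrow> f z \<noteq> 0 \<Longrightarrow> i \<le> num_ge \<epsilon> z"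
    using MM_test_functionE[OF i f] by metis
  have B: "\<bar>zero_ext i f z\<bar> \<le> B" for z using B' \<open>B > 0\<close> by (auto simp: zero_ext_def indicator_def)
  have supp: "i \<le> num_ge \<epsilon> z" if "zero_ext i f z \<noteq> 0" for z
    using supp' that by (auto simp: zero_ext_def indicator_def split: if_splits)
  have e2: "0 < \<epsilon> / 2" using \<epsilon> by simp
  obtain CX where CX: "CX > 0" "\<forall>\<^sub>F t in at_top. t * tail_prob P X i (\<epsilon> / 2 * b i t) \<le> CX"
    using MRV_tail_upper[OF P i Xi e2] .
  obtain CY where CY: "CY > 0" "\<forall>\<^sub>F t in at_top. t * tail_prob P Y i (\<epsilon> / 2 * b i t) \<le> CY"
    using MRV_tail_upper[OF P i Yi e2] .
  have cross: "((\<lambda>t. t * (tail_prob P X m (\<eta> * b i t) * tail_prob P Y (max 1 (i - m)) (\<eta> * b i t))) \<longlongrightarrow> 0) at_top"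
    if m: "m \<in> {1..i}" and \<eta>: "0 < \<eta>" for m \<eta>
  proof (rule cross_tail_tendsto_0[OF P i Xi _ _ X _ _ Y _ \<eta>])
    \<comment> \<open>For \<open>m = i\<close> this is positivity of \<open>\<alpha> 1\<close>.\<close>
    show "\<alpha> i < \<alpha> m + \<alpha> (max 1 (i - m))"
    proof (cases "m = i")
      case True
      have "0 < \<alpha> 1" using X[of 1] i by (simp add: MRV_def)
      then show ?thesis using True by simp
    next
      case False
      then show ?thesis using less[of i m] m i by (auto simp: max_def)
    qed
  qed (use m i in auto)
  show ?thesis
  proof (rule tendsto_0_if_arbitrarily_small[where K = "CX + CY + 4 * B + 1"])
    fix \<kappa> :: real assume \<kappa>: "0 < \<kappa>"
    obtain RX where RX: "\<forall>\<^sub>F t in at_top. t * measure P {\<omega> \<in> space P. i \<le> num_ge (\<epsilon> / 2 * b i t) (X \<omega>) \<and>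
        RX \<le> norm (X \<omega> /\<^sub>R b i t)} \<le> \<kappa>"
      using MRV_tight[OF P i Xi e2 \<kappa>] .
    obtain RY where RY: "\<forall>\<^sub>F t in at_top. t * measure P {\<omega> \<in> space P. i \<le> num_ge (\<epsilon> / 2 * b i t) (Y \<omega>) \<and>
        RY \<le> norm (Y \<omega> /\<^sub>R b i t)} \<le> \<kappa>"
      using MRV_tight[OF P i Yi e2 \<kappa>] .
    show "\<forall>\<^sub>F t in at_top. \<bar>t * ((\<integral>\<omega>. zero_ext i f ((X \<omega> + Y \<omega>) /\<^sub>R b i t) \<partial>P)
      - (\<integral>\<omega>. zero_ext i f (X \<omega> /\<^sub>R b i t) \<partial>P) - (\<integral>\<omega>. zero_ext i f (Y \<omega> /\<^sub>R b i t) \<partial>P))\<bar> \<le> (CX + CY + 4 * B + 1) * \<kappa>"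
    proof -
      obtain \<eta>0 where \<eta>0: "0 < \<eta>0" and cont0: "\<And>z w. z \<in> nonneg_orthant \<Longrightarrow> w \<in> nonneg_orthant \<Longrightarrow>
          norm z \<le> max RX RY \<Longrightarrow> \<forall>j. w $ j < \<eta>0 \<Longrightarrow> \<bar>zero_ext i f (z + w) - zero_ext i f z\<bar> \<le> \<kappa>"
        using shift_modulus[OF continuous_on_zero_ext[OF i f] \<kappa>, of "max RX RY"] by blast
      define \<eta> where "\<eta> = min \<eta>0 (\<epsilon> / 2)"
      have \<eta>: "0 < \<eta>" "\<eta> \<le> \<epsilon> / 2" using \<eta>0 \<epsilon> by (auto simp: \<eta>_def)
      have cont: "\<bar>zero_ext i f (z + w) - zero_ext i f z\<bar> \<le> \<kappa>"
        if "z \<in> nonneg_orthant" "w \<in> nonneg_orthant" "norm z \<le> max RX RY" "\<forall>j. w $ j < \<eta>" for z w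
        using that by (intro cont0) (auto simp: \<eta>_def)
      define S where "S t = (\<Sum>m\<in>{1..i}. tail_prob P X m (\<eta> * b i t) * tail_prob P Y (max 1 (i - m)) (\<eta> * b i t))" for t
      have "((\<lambda>t. t * S t) \<longlongrightarrow> (\<Sum>m\<in>{1..i}. 0)) at_top"
        unfolding S_def sum_distrib_left by (intro tendsto_sum cross \<eta>)
      then have "((\<lambda>t. 3 * B * (t * S t)) \<longlongrightarrow> 3 * B * (\<Sum>m\<in>{1..i}. 0)) at_top"
        by (rule tendsto_mult_left)
      then have "\<forall>\<^sub>F t in at_top. 3 * B * (t * S t) < \<kappa>"
        using \<kappa> by (intro order_tendstoD(2)) auto
      with CX(2) CY(2) RX RY regularly_varying_pos[OF b] eventually_ge_at_top[of 0] show ?thesis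
      proof eventually_elim
        case (elim t)
        let ?D = "(\<integral>\<omega>. zero_ext i f ((X \<omega> + Y \<omega>) /\<^sub>R b i t) \<partial>P)
          - (\<integral>\<omega>. zero_ext i f (X \<omega> /\<^sub>R b i t) \<partial>P) - (\<integral>\<omega>. zero_ext i f (Y \<omega> /\<^sub>R b i t) \<partial>P)"
        let ?TX = "tail_prob P X i (\<epsilon> / 2 * b i t)" and ?TY = "tail_prob P Y i (\<epsilon> / 2 * b i t)"
        let ?VX = "measure P {\<omega> \<in> space P. i \<le> num_ge (\<epsilon> / 2 * b i t) (X \<omega>) \<and> RX \<le> norm (X \<omega> /\<^sub>R b i t)}"
        let ?VY = "measure P {\<omega> \<in> space P. i \<le> num_ge (\<epsilon> / 2 * b i t) (Y \<omega>) \<and> RY \<le> norm (Y \<omega> /\<^sub>R b i t)}"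
        have "\<bar>?D\<bar> \<le> \<kappa> * ?TX + 2 * B * ?VX + \<kappa> * ?TY + 2 * B * ?VY + 3 * B * S t"
          unfolding S_def
          by (rule expected_defect_bound[OF P i Xm Ym indep f elim(5) B supp \<eta> less_imp_le[OF \<kappa>] cont])
        then have "t * \<bar>?D\<bar> \<le> t * (\<kappa> * ?TX + 2 * B * ?VX + \<kappa> * ?TY + 2 * B * ?VY + 3 * B * S t)"
          using elim by (intro mult_left_mono)
        also have "\<dots> = \<kappa> * (t * ?TX) + 2 * B * (t * ?VX) + \<kappa> * (t * ?TY) + 2 * B * (t * ?VY) + 3 * B * (t * S t)"
          by (simp add: algebra_simps)
        also have "\<dots> \<le> \<kappa> * CX + 2 * B * \<kappa> + \<kappa> * CY + 2 * B * \<kappa> + \<kappa>"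
          using elim \<kappa> \<open>B > 0\<close> by (intro add_mono mult_left_mono) auto
        also have "\<dots> = (CX + CY + 4 * B + 1) * \<kappa>" by (simp add: algebra_simps)
        finally show ?case using elim by (simp add: abs_mult)
      qed
    qed
  qed
qed

lemma MRV_add:
  fixes X Y :: "'a \<Rightarrow> real ^ 'd"
  assumes P: "prob_space P"
    and X: "\<And>i. i \<in> {1..CARD('d)} \<Longrightarrow> MRV P X (\<alpha> i) (b i) (\<mu> i) i"
    and Y: "\<And>i. i \<in> {1..CARD('d)} \<Longrightarrow> MRV P Y (\<alpha> i) (b i) (\<nu> i) i"
    and indep: "prob_space.indep_var P borel X borel Y"
    and less: "\<And>i m. i \<in> {2..CARD('d)} \<Longrightarrow> m \<in> {1..i - 1} \<Longrightarrow> \<alpha> i < \<alpha> m + \<alpha> (i - m)"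
    and i: "i \<in> {1..CARD('d)}"
    and \<rho>: "\<rho> \<in> MM i" "emeasure \<rho> (space \<rho>) \<noteq> 0"
      "\<And>f. MM_test_function i f \<Longrightarrow> integral\<^sup>L \<rho> f = integral\<^sup>L (\<mu> i) f + integral\<^sup>L (\<nu> i) f"
  shows "MRV P (\<lambda>\<omega>. X \<omega> + Y \<omega>) (\<alpha> i) (b i) \<rho> i"
proof -
  have i': "1 \<le> i" "i \<le> CARD('d)" using i by auto
  note Xi = X[OF i] and Yi = Y[OF i]
  have Sm: "(\<lambda>\<omega>. X \<omega> + Y \<omega>) \<in> borel_measurable P"
    using Xi Yi by (intro borel_measurable_add) (auto simp: MRV_def)
  have "MM_converges i (\<lambda>t. scaled_law i P (\<lambda>\<omega>. X \<omega> + Y \<omega>) t (b i t)) \<rho>"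
    unfolding MM_converges_def
  proof (intro allI impI)
    fix f :: "real ^ 'd \<Rightarrow> real" assume f: "MM_test_function i f"
    let ?E = "\<lambda>W t. \<integral>\<omega>. zero_ext i f (W \<omega> /\<^sub>R b i t) \<partial>P"
    let ?S = "\<lambda>\<omega>. X \<omega> + Y \<omega>"
    have "((\<lambda>t. t * (?E ?S t - ?E X t - ?E Y t) + (t * ?E X t + t * ?E Y t)) \<longlongrightarrow>
        0 + (integral\<^sup>L (\<mu> i) f + integral\<^sup>L (\<nu> i) f)) at_top"
      by (intro tendsto_add defect_tendsto_0[OF P X Y indep less i' f] MRV_tendsto[OF i' Xi f] MRV_tendsto[OF i' Yi f])
    then have "((\<lambda>t. t * ?E ?S t) \<longlongrightarrow> integral\<^sup>L \<rho> f) at_top"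
      by (simp add: \<rho>(3)[OF f] algebra_simps)
    moreover have "\<forall>\<^sub>F t in at_top. t * ?E ?S t = integral\<^sup>L (scaled_law i P ?S t (b i t)) f"
      using eventually_ge_at_top[of 0] by eventually_elim (rule integral_scaled_law[OF i' f _ Sm, symmetric])
    ultimately show "((\<lambda>t. integral\<^sup>L (scaled_law i P ?S t (b i t)) f) \<longlongrightarrow> integral\<^sup>L \<rho> f) at_top"
      by (rule Lim_transform_eventually)
  qed
  then show ?thesis using Xi Yi \<rho> Sm by (auto simp: MRV_def nonneg_orthant_def)
qed

section \<open>Sums of finitely many vectors\<close>

lemma MRV_distr_cong:
  fixes X Y :: "'a \<Rightarrow> real ^ 'd"
  assumes X: "MRV P X \<alpha> b \<mu> i" and Y: "Y \<in> borel_measurable P" "\<And>\<omega>. \<omega> \<in> space P \<Longrightarrow> Y \<omega> \<in> nonneg_orthant"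
    and eq: "distr P borel Y = distr P borel X"
  shows "MRV P Y \<alpha> b \<mu> i"
proof -
  have "distr P borel (\<lambda>\<omega>. W \<omega> /\<^sub>R s) = distr (distr P borel W) borel (\<lambda>z. z /\<^sub>R s)"
    if "W \<in> borel_measurable P" for W :: "'a \<Rightarrow> real ^ 'd" and s
    using that by (subst distr_distr) (auto simp: comp_def)
  then have "scaled_law i P Y = scaled_law i P X"
    using X Y(1) eq by (auto simp: scaled_law_def fun_eq_iff MRV_def)
  then show ?thesis using X Y by (simp add: MRV_def)
qed

lemma MM_scale_measure:
  assumes "\<mu> \<in> MM i" shows "scale_measure (of_nat n) \<mu> \<in> MM i"
  using assms by (auto simp: MM_def ennreal_mult_less_top of_nat_less_top)

lemma indep_var_vector_sum:
  fixes X :: "'i \<Rightarrow> 'a \<Rightarrow> 'v::euclidean_space"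
  assumes "prob_space P" and I: "finite I" "k \<notin> I"
    and indep: "prob_space.indep_vars P (\<lambda>_. borel) X (insert k I)"
  shows "prob_space.indep_var P borel (\<lambda>\<omega>. \<Sum>l\<in>I. X l \<omega>) borel (X k)"
proof -
  interpret prob_space P by fact
  have "indep_var
    borel ((\<lambda>f. \<Sum>l\<in>I. f l) \<circ> (\<lambda>\<omega>. restrict (\<lambda>l. X l \<omega>) I))
    borel ((\<lambda>f. f k) \<circ> (\<lambda>\<omega>. restrict (\<lambda>l. X l \<omega>) {k}))"
    using I by (intro indep_var_compose[OF indep_var_restrict[OF indep]]) auto
  also have "((\<lambda>f. f k) \<circ> (\<lambda>\<omega>. restrict (\<lambda>l. X l \<omega>) {k})) = X k" by auto
  also have "((\<lambda>f. \<Sum>l\<in>I. f l) \<circ> (\<lambda>\<omega>. restrict (\<lambda>l. X l \<omega>) I)) = (\<lambda>\<omega>. \<Sum>l\<in>I. X l \<omega>)"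
    by (auto cong: rev_conj_cong)
  finally show ?thesis .
qed

theorem proposition3p5:
  fixes P :: "'a measure"
    and Z :: "nat \<Rightarrow> 'a \<Rightarrow> real ^ 'd"
    and n :: nat
    and \<alpha> :: "nat \<Rightarrow> real"
    and b :: "nat \<Rightarrow> real \<Rightarrow> real"
    and \<mu> :: "nat \<Rightarrow> (real ^ 'd) measure"
  assumes "prob_space P"
    and "1 \<le> n"
    and "\<And>k. k \<in> {1..n} \<Longrightarrow> Z k \<in> borel_measurable P"
    and "\<And>k \<omega>. k \<in> {1..n} \<Longrightarrow> \<omega> \<in> space P \<Longrightarrow> Z k \<omega> \<in> nonneg_orthant"
    and "prob_space.indep_vars P (\<lambda>_. borel) Z {1..n}"
    and "\<And>k. k \<in> {1..n} \<Longrightarrow> distr P borel (Z k) = distr P borel (Z 1)"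
    and "\<And>j l. tail_equivalent (cdf (distr P borel (\<lambda>\<omega>. Z 1 \<omega> $ j)))
                              (cdf (distr P borel (\<lambda>\<omega>. Z 1 \<omega> $ l)))"
    and "\<And>i. i \<in> {1..CARD('d)} \<Longrightarrow> MRV P (Z 1) (\<alpha> i) (b i) (\<mu> i) i"
    and "\<And>i m. i \<in> {2..CARD('d)} \<Longrightarrow> m \<in> {1..i - 1} \<Longrightarrow> \<alpha> i < \<alpha> m + \<alpha> (i - m)"
  shows "\<forall>i\<in>{1..CARD('d)}.
           MRV P (\<lambda>\<omega>. \<Sum>k=1..n. Z k \<omega>) (\<alpha> i) (b i) (scale_measure (of_nat n) (\<mu> i)) i"
proof -
  interpret prob_space P by fact
  note MRV1 = assms(8) and subadditive = assms(9)
  have "\<forall>i\<in>{1..CARD('d)}.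
      MRV P (\<lambda>\<omega>. \<Sum>k=1..N. Z k \<omega>) (\<alpha> i) (b i) (scale_measure (of_nat N) (\<mu> i)) i"
    if "1 \<le> N" "N \<le> n" for N
    using that
  proof (induction N rule: dec_induct)
    case base
    then show ?case using MRV1 by simp
  next
    case (step N)
    let ?S = "\<lambda>\<omega>. \<Sum>k=1..N. Z k \<omega>"
    have N: "Suc N \<in> {1..n}" using step by simp
    have S: "MRV P ?S (\<alpha> i) (b i) (scale_measure (of_nat N) (\<mu> i)) i" if "i \<in> {1..CARD('d)}" for i
      using step that by simp
    have Z: "MRV P (Z (Suc N)) (\<alpha> i) (b i) (\<mu> i) i" if "i \<in> {1..CARD('d)}" for i
      by (rule MRV_distr_cong[OF MRV1[OF that] assms(3)[OF N] assms(4)[OF N] assms(6)[OF N]])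
    have "indep_vars (\<lambda>_. borel) Z (insert (Suc N) {1..N})"
      by (rule indep_vars_subset[OF assms(5)]) (use N in auto)
    then have indep: "indep_var borel ?S borel (Z (Suc N))"
      by (intro indep_var_vector_sum assms(1)) auto
    show ?case
    proof
      fix i assume i: "i \<in> {1..CARD('d)}"
      have i': "1 \<le> i" "i \<le> CARD('d)" using i by auto
      have \<mu>: "\<mu> i \<in> MM i" "emeasure (\<mu> i) (space (\<mu> i)) \<noteq> 0" using MRV1[OF i] by (auto simp: MRV_def)
      have scale: "integral\<^sup>L (scale_measure (of_nat k) (\<mu> i)) f = real k * integral\<^sup>L (\<mu> i) f"
        if "MM_test_function i f" for k f
        using integral_scale_measure[of "real k" f "\<mu> i"] MM_integrable_test[OF i' \<mu>(1) that]
        by (simp add: borel_measurable_integrable ennreal_of_nat_eq_real_of_nat)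
      have "MRV P (\<lambda>\<omega>. ?S \<omega> + Z (Suc N) \<omega>) (\<alpha> i) (b i) (scale_measure (of_nat (Suc N)) (\<mu> i)) i"
      proof (rule MRV_add[OF assms(1) S Z indep subadditive i])
        show "scale_measure (of_nat (Suc N)) (\<mu> i) \<in> MM i" by (rule MM_scale_measure[OF \<mu>(1)])
        show "emeasure (scale_measure (of_nat (Suc N)) (\<mu> i)) (space (scale_measure (of_nat (Suc N)) (\<mu> i))) \<noteq> 0"
          using \<mu>(2) by (simp add: space_scale_measure)
        show "integral\<^sup>L (scale_measure (of_nat (Suc N)) (\<mu> i)) f
            = integral\<^sup>L (scale_measure (of_nat N) (\<mu> i)) f + integral\<^sup>L (\<mu> i) f"
          if "MM_test_function i f" for f
          unfolding scale[OF that] by (simp add: algebra_simps)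
      qed
      then show "MRV P (\<lambda>\<omega>. \<Sum>k=1..Suc N. Z k \<omega>) (\<alpha> i) (b i) (scale_measure (of_nat (Suc N)) (\<mu> i)) i"
        by (simp only: sum.cl_ivl_Suc) simp
    qed
  qed
  then show ?thesis using assms(2) by simp
qed

end
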